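(* Let $Y$ be a Lévy process in $\mathbb{R}^d$. The following are equivalent: (C1) The density $p(t,x)$ of $Y_t$ exists and there are $T_1\in(0,\infty]$, $c_1>0$ such that $\sup_{x\in\mathbb{R}^d}p(t,x)\le c_1[h^{-1}(1/t)]^{-d}$ for all $0<t<T_1$. (C2) There are $T_2\in(0,\infty]$, $c_2>0$ such that $\int_{\mathbb{R}^d}e^{-t\,\mathrm{Re}[\Psi(z)]}dz\le c_2[h^{-1}(1/t)]^{-d}$ for all $0<t<T_2$. (C3) There are $T_3\in(0,\infty]$, $c_3\in(0,1]$, $\alpha_3\in(0,2]$ such that $c_3\Psi^*(|x|)\le \mathrm{Re}[\Psi(x)]$ for all $|x|>1/T_3$, and $\Psi^*(\lambda r)\ge c_3\lambda^{\alpha_3}\Psi^*(r)$ for all $\lambda\ge1$, $r>1/T_3$. (C4) There are $T_4\in(0,\infty]$, $c_4\in[1,\infty)$ such that for all $|x|>1/T_4$, $\Psi^*(|x|)\le c_4\big(\langle x,Ax\rangle+\int_{|\langle x,z\rangle|<1}|\langle x,z\rangle|^2N(dz)\big)$. Moreover, if one of (C1)–(C4) holds with $T_i=\infty$, then each of (C1)–(C4) holds with $T_i=\infty$.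
   Context: $Y$ has generating triplet $(A,N,b)$: $A$ symmetric non-negative definite matrix, $b\in\mathbb{R}^d$, $N$ Lévy measure; $\Psi$ is the characteristic exponent, $\mathbb{E}e^{i\langle x,Y_t\rangle}=e^{-t\Psi(x)}$, $\Psi(x)=\langle x,Ax\rangle-i\langle x,b\rangle-\int(e^{i\langle x,z\rangle}-1-i\langle x,z\rangle\mathbf{1}_{|z|<1})N(dz)$. For $r>0$: $h(r)=r^{-2}\|A\|+\int(1\wedge|x|^2/r^2)N(dx)$ and $\Psi^*(r)=\sup_{|z|\le r}\mathrm{Re}\,\Psi(z)$. Standing assumption $h(0^+)=\infty$ (i.e. $Y$ is not a compound Poisson process with drift); $h$ is continuous strictly decreasing from $\infty$ to $0$, $h^{-1}$ its inverse. Convention $1/\infty=0$. *)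

theory Defs
  imports "HOL-Probability.Probability"
begin

text \<open>Generating triplet (A, N, b) on R^d, modelled as real^'n with d = CARD('n).\<close>

definition is_levy_measure :: "(real^'n) measure \<Rightarrow> bool" where
  "is_levy_measure N \<longleftrightarrow> sets N = sets borel \<and> emeasure N {0} = 0 \<and>
     (\<integral>\<^sup>+ z. ennreal (min 1 (norm z ^ 2)) \<partial>N) < \<infinity>"

definition levy_exponent :: "real^'n^'n \<Rightarrow> real^'n \<Rightarrow> (real^'n) measure \<Rightarrow> real^'n \<Rightarrow> complex" where
  "levy_exponent A b N x =
     complex_of_real (x \<bullet> (A *v x)) - \<i> * complex_of_real (x \<bullet> b)
     - (CLINT z|N. cis (x \<bullet> z) - 1 - \<i> * complex_of_real ((x \<bullet> z) * indicator (ball 0 1) z))"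

definition levy_h :: "real^'n^'n \<Rightarrow> (real^'n) measure \<Rightarrow> real \<Rightarrow> real" where
  "levy_h A N r = onorm (\<lambda>x. A *v x) / r\<^sup>2 + (\<integral> z. min 1 (norm z ^ 2 / r\<^sup>2) \<partial>N)"

definition levy_h_inv :: "real^'n^'n \<Rightarrow> (real^'n) measure \<Rightarrow> real \<Rightarrow> real" where
  "levy_h_inv A N u = (THE r. 0 < r \<and> levy_h A N r = u)"

definition psi_star :: "real^'n^'n \<Rightarrow> real^'n \<Rightarrow> (real^'n) measure \<Rightarrow> real \<Rightarrow> real" where
  "psi_star A b N r = (SUP z\<in>cball 0 r. Re (levy_exponent A b N z))"

text \<open>Conditions (C1)-(C4), parameterised by T in (0,infinity] (as ereal; 1/infinity = 0 in ereal).
  mu t is the law of Y_t.\<close>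

definition cond_C1 :: "(real \<Rightarrow> (real^'n) measure) \<Rightarrow> real^'n^'n \<Rightarrow> (real^'n) measure \<Rightarrow> ereal \<Rightarrow> bool" where
  "cond_C1 \<mu> A N T \<longleftrightarrow>
    (\<exists>p :: real \<Rightarrow> real^'n \<Rightarrow> real.
       (\<forall>t>0. p t \<in> borel_measurable lborel \<and> (\<forall>x. 0 \<le> p t x) \<and>
              \<mu> t = density lborel (\<lambda>x. ennreal (p t x))) \<and>
       (\<exists>c>0. \<forall>t>0. ereal t < T \<longrightarrow>
          (\<forall>x. p t x \<le> c * levy_h_inv A N (1 / t) powr (- real CARD('n)))))"

definition cond_C2 :: "real^'n^'n \<Rightarrow> real^'n \<Rightarrow> (real^'n) measure \<Rightarrow> ereal \<Rightarrow> bool" where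
  "cond_C2 A b N T \<longleftrightarrow>
    (\<exists>c>0. \<forall>t>0. ereal t < T \<longrightarrow>
       (\<integral>\<^sup>+ z. ennreal (exp (- t * Re (levy_exponent A b N z))) \<partial>(lborel :: (real^'n) measure))
         \<le> ennreal (c * levy_h_inv A N (1 / t) powr (- real CARD('n))))"

definition cond_C3 :: "real^'n^'n \<Rightarrow> real^'n \<Rightarrow> (real^'n) measure \<Rightarrow> ereal \<Rightarrow> bool" where
  "cond_C3 A b N T \<longleftrightarrow>
    (\<exists>c \<alpha>. 0 < c \<and> c \<le> 1 \<and> 0 < \<alpha> \<and> \<alpha> \<le> 2 \<and>
       (\<forall>x::real^'n. ereal (norm x) > 1 / T \<longrightarrow>
          c * psi_star A b N (norm x) \<le> Re (levy_exponent A b N x)) \<and>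
       (\<forall>l r. l \<ge> 1 \<and> ereal r > 1 / T \<longrightarrow>
          psi_star A b N (l * r) \<ge> c * l powr \<alpha> * psi_star A b N r))"

definition cond_C4 :: "real^'n^'n \<Rightarrow> real^'n \<Rightarrow> (real^'n) measure \<Rightarrow> ereal \<Rightarrow> bool" where
  "cond_C4 A b N T \<longleftrightarrow>
    (\<exists>c. 1 \<le> c \<and>
       (\<forall>x::real^'n. ereal (norm x) > 1 / T \<longrightarrow>
          psi_star A b N (norm x) \<le>
            c * (x \<bullet> (A *v x) + (\<integral> z. indicator {z. \<bar>x \<bullet> z\<bar> < 1} z * (x \<bullet> z)\<^sup>2 \<partial>N))))"

end

theory Submission
  imports Defs
begin

text \<open>
  Write \<open>V x\<close> for the bracket on the right-hand side of (C4). Averaging over dilations shows that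
  \<open>\<Psi>*(r)\<close> and \<open>h(1/r)\<close> are comparable. It suffices to prove
  (C1) or (C2) \<open>\<Longrightarrow>\<close> (C4) \<open>\<Longrightarrow>\<close> (C3) \<open>\<Longrightarrow>\<close> (C2) \<open>\<Longrightarrow>\<close> (C1).

  (C1) or (C2) \<open>\<Longrightarrow>\<close> (C4): by Plancherel, (C1) bounds the integral of \<open>exp (- 2 t Re \<Psi>)\<close>. If \<open>V x\<close> were
  much smaller than \<open>h(1/|x|) = 1/t\<close>, then \<open>t Re \<Psi>\<close> would be bounded on many disjoint balls of
  radius \<open>|x|\<close> along the line through \<open>x\<close>, and the integral would exceed its bound.

  (C4) \<open>\<Longrightarrow>\<close> (C3): for \<open>F x = \<langle>x, A x\<rangle> + \<integral> min(1, \<langle>x, z\<rangle>\<^sup>2) N(dz)\<close> one has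
  \<open>F (2x) - F x \<ge> 3/4 V (2x)\<close>, so (C4) makes \<open>F\<close> grow geometrically along dyadic dilations.

  (C3) \<open>\<Longrightarrow>\<close> (C2) is integration over dyadic shells, and (C2) \<open>\<Longrightarrow>\<close> (C1) is Fourier inversion, obtained by
  smoothing with a Gaussian.
\<close>

section \<open>Fourier analysis of probability measures\<close>

text \<open>Time and frequency are matched by \<open>t = 1 / h (1 / |x|)\<close>. Then
  \<open>h_inv (1 / t) = 1 / |x|\<close>, so the bounds in (C1) and (C2) become a constant times
  \<open>|x|^d\<close>, which is comparable to the volume of one ball of radius \<open>|x|\<close>.
  A number of balls depending only on the constants thus gives the contradiction behind (C4). The
  balls lie along \<open>x\<close> because splitting the jumps at \<open>|<x,z>| = 1\<close> bounds
  \<open>Re \<Psi> (m x)\<close> by \<open>m^2 V x + 2 h (1 / |x|)\<close>. Truncation makes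
  \<open>V\<close> lose jumps as \<open>x\<close> grows, so \<open>V\<close> is not monotone along
  rays; \<open>F\<close> is, and it lies between \<open>V x\<close> and \<open>h (1 / |x|)\<close>.
  Square integrability of the characteristic function is a conclusion of the Plancherel step. A
  Gaussian factor makes every integral there finite, and Fatou's lemma removes it. The range
  \<open>T\<close> is kept by (C4) to (C3) and by (C2) to (C1). A finite \<open>T\<close> becomes
  \<open>h_inv (1 / T)\<close> on the way into (C4) and \<open>1 / h T\<close> from (C3) to (C2); an
  infinite one stays infinite, so the same cycle proves the last claim.\<close>

lemma measurable_cis [measurable (raw)]:
  "f \<in> borel_measurable M \<Longrightarrow> (\<lambda>x. cis (f x)) \<in> borel_measurable M"
  by (rule borel_measurable_continuous_onI[THEN measurable_compose_rev]) (intro continuous_intros)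

section \<open>Fourier transforms of Gaussians\<close>

lemma std_normal_fourier:
  "has_bochner_integral lborel (\<lambda>u. cis (u * y) * of_real (exp (- u\<^sup>2 / 2)))
     (complex_of_real (sqrt (2 * pi) * exp (- y\<^sup>2 / 2)))"
proof -
  interpret real_distribution std_normal_distribution
    by (rule real_dist_normal_dist)
  have "has_bochner_integral std_normal_distribution (\<lambda>u. cis (u * y)) (complex_of_real (exp (- y\<^sup>2 / 2)))"
    using fun_cong[OF char_std_normal_distribution, of y]
    by (auto simp: has_bochner_integral_iff char_def cis_conv_exp mult.commute
             intro!: integrable_const_bound[where B=1])
  then have "has_bochner_integral lborel (\<lambda>u. std_normal_density u *\<^sub>R cis (u * y)) (complex_of_real (exp (- y\<^sup>2 / 2)))"
    by (simp add: has_bochner_integral_iff integrable_density integral_density)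
  from has_bochner_integral_mult_right[OF this, of "complex_of_real (sqrt (2*pi))"]
  show ?thesis
    by (simp add: std_normal_density_def scaleR_conv_of_real mult_ac real_sqrt_mult)
qed

lemma gaussian_fourier_real:
  fixes \<sigma> x :: real
  assumes "\<sigma> > 0"
  shows "has_bochner_integral lborel (\<lambda>s. cis (s * x) * of_real (exp (- (\<sigma> * s)\<^sup>2 / 2)))
     (complex_of_real (sqrt (2 * pi) / \<sigma> * exp (- (x / \<sigma>)\<^sup>2 / 2)))"
  using iffD1[OF lborel_has_bochner_integral_real_affine_iff[of \<sigma> _ _ 0] std_normal_fourier[of "x / \<sigma>"]] assms
  by (simp add: scaleR_conv_of_real field_simps)

text \<open>Lebesgue measure is the image of a product of one-dimensional Lebesgue measures under
  the coordinate map, so integrals of products of coordinate functions factor.\<close>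

lemma lborel_integral_prod:
  fixes f :: "'a::euclidean_space \<Rightarrow> real \<Rightarrow> complex"
  assumes "\<And>b. b \<in> Basis \<Longrightarrow> has_bochner_integral lborel (f b) (I b)"
  shows "has_bochner_integral lborel (\<lambda>z. \<Prod>b\<in>Basis. f b (z \<bullet> b)) (\<Prod>b\<in>Basis. I b)"
proof -
  interpret product_sigma_finite "\<lambda>_::'a. lborel :: real measure" ..
  have int: "integrable lborel (f b)" and I: "integral\<^sup>L lborel (f b) = I b" if "b \<in> Basis" for b
    using assms[OF that] by (auto simp: has_bochner_integral_iff)
  have [measurable]: "f b \<in> borel_measurable borel" if "b \<in> Basis" for b
    using borel_measurable_integrable[OF int[OF that]] by simp
  have "has_bochner_integral (\<Pi>\<^sub>M b\<in>(Basis::'a set). lborel) (\<lambda>x. \<Prod>b\<in>Basis. f b (x b)) (\<Prod>b\<in>Basis. I b)"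
    using product_integrable_prod[OF _ int] product_integral_prod[OF _ int] I
    by (auto simp: has_bochner_integral_iff)
  then have "has_bochner_integral (distr (\<Pi>\<^sub>M b\<in>(Basis::'a set). lborel) borel (\<lambda>f. \<Sum>b\<in>Basis. f b *\<^sub>R b))
     (\<lambda>z. \<Prod>b\<in>Basis. f b (z \<bullet> b)) (\<Prod>b\<in>Basis. I b)"
    by (intro has_bochner_integral_distr) auto
  then show ?thesis
    by (subst lborel_eq)
qed

lemma cis_sum: "finite S \<Longrightarrow> cis (\<Sum>b\<in>S. f b) = (\<Prod>b\<in>S. cis (f b))"
  by (induction S rule: finite_induct) (auto simp: cis_mult[symmetric])

text \<open>The density of the centred normal law whose covariance is \<open>\<sigma>^2\<close>
  times the identity.\<close>

definition gauss_density :: "real \<Rightarrow> 'a::euclidean_space \<Rightarrow> real" where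
  "gauss_density \<sigma> x = exp (- (norm x)\<^sup>2 / (2 * \<sigma>\<^sup>2)) / (sqrt (2 * pi) * \<sigma>) ^ DIM('a)"

lemma gauss_density_nonneg [simp]: "\<sigma> > 0 \<Longrightarrow> 0 \<le> gauss_density \<sigma> x"
  by (auto simp: gauss_density_def)

lemma gauss_density_measurable [measurable]: "gauss_density \<sigma> \<in> borel_measurable borel"
  unfolding gauss_density_def by measurable

lemma norm_sq_eq_sum_Basis: "(norm z)\<^sup>2 = (\<Sum>e\<in>Basis. (e \<bullet> z)\<^sup>2)" for z :: "'a::euclidean_space"
  by (subst power2_norm_eq_inner, subst euclidean_inner) (simp add: power2_eq_square inner_commute)

lemma two_pi_power: "(2 * pi) ^ n = sqrt (2 * pi) ^ n * sqrt (2 * pi) ^ n"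
  by (subst power_mult_distrib[symmetric]) simp

lemma gaussian_fourier:
  fixes x :: "'a::euclidean_space"
  assumes "\<sigma> > 0"
  shows "has_bochner_integral lborel (\<lambda>z. cis (z \<bullet> x) * of_real (exp (- (\<sigma> * norm z)\<^sup>2 / 2)))
     (complex_of_real ((2 * pi) ^ DIM('a) * gauss_density \<sigma> x))"
proof -
  have exp_prod: "exp (- (c * (norm z)\<^sup>2) / 2) = (\<Prod>b\<in>Basis. exp (- (c * (z \<bullet> b)\<^sup>2) / 2))" for c and z :: 'a
    by (simp add: norm_sq_eq_sum_Basis inner_commute exp_sum[symmetric] sum_distrib_left sum_negf sum_divide_distrib)
  have *: "cis (z \<bullet> x) * of_real (exp (- (\<sigma> * norm z)\<^sup>2 / 2)) =
      (\<Prod>b\<in>Basis. cis ((z \<bullet> b) * (x \<bullet> b)) * of_real (exp (- (\<sigma> * (z \<bullet> b))\<^sup>2 / 2)))" for z :: 'a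
    using exp_prod[of "\<sigma>\<^sup>2" z]
    by (subst euclidean_inner) (simp add: cis_sum prod.distrib power_mult_distrib)
  have **: "(\<Prod>b\<in>Basis. complex_of_real (sqrt (2 * pi) / \<sigma> * exp (- (x \<bullet> b / \<sigma>)\<^sup>2 / 2))) =
     complex_of_real ((2 * pi) ^ DIM('a) * gauss_density \<sigma> x)"
  proof -
    have "(\<Prod>b\<in>Basis. sqrt (2 * pi) / \<sigma> * exp (- (x \<bullet> b / \<sigma>)\<^sup>2 / 2)) =
        (sqrt (2 * pi) / \<sigma>) ^ DIM('a) * exp (- (1 / \<sigma>\<^sup>2 * (norm x)\<^sup>2) / 2)"
      by (subst exp_prod) (simp only: prod.distrib prod_constant, simp add: power_divide)
    also have "\<dots> = (2 * pi) ^ DIM('a) * gauss_density \<sigma> x"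
      unfolding two_pi_power gauss_density_def using assms
      by (simp add: power_divide power_mult_distrib mult.commute)
    finally show ?thesis by (simp only: of_real_prod[symmetric])
  qed
  show ?thesis
    unfolding * **[symmetric]
    using gaussian_fourier_real[OF assms] by (intro lborel_integral_prod) auto
qed

text \<open>The total mass is the transform in \<open>gaussian_fourier\<close> at frequency 0, with
  \<open>1 / \<sigma>\<close> in place of \<open>\<sigma>\<close>.\<close>

lemma gauss_density_integral:
  assumes "\<sigma> > 0"
  shows "has_bochner_integral lborel (gauss_density \<sigma> :: 'a::euclidean_space \<Rightarrow> real) 1"
proof -
  have "has_bochner_integral lborel (\<lambda>z::'a. complex_of_real (exp (- (norm z / \<sigma>)\<^sup>2 / 2)))
     (complex_of_real ((2 * pi) ^ DIM('a) * gauss_density (1/\<sigma>) (0::'a)))"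
    using gaussian_fourier[of "1/\<sigma>" "0::'a"] assms by simp
  then have "has_bochner_integral lborel (\<lambda>z::'a. exp (- (norm z / \<sigma>)\<^sup>2 / 2)) ((2 * pi) ^ DIM('a) * gauss_density (1/\<sigma>) (0::'a))"
    using has_bochner_integral_Re by fastforce
  moreover have "(2 * pi) ^ DIM('a) * gauss_density (1/\<sigma>) (0::'a) = (sqrt (2 * pi) * \<sigma>) ^ DIM('a)"
    unfolding two_pi_power gauss_density_def using assms
    by (simp add: power_mult_distrib power_divide)
  ultimately have "has_bochner_integral lborel (\<lambda>z::'a. exp (- (norm z / \<sigma>)\<^sup>2 / 2) / (sqrt (2 * pi) * \<sigma>) ^ DIM('a))
      ((sqrt (2 * pi) * \<sigma>) ^ DIM('a) / (sqrt (2 * pi) * \<sigma>) ^ DIM('a))"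
    by (intro has_bochner_integral_divide_zero) simp
  then show ?thesis
    using assms by (simp add: gauss_density_def[abs_def] power_divide mult.commute)
qed

section \<open>Characteristic functions and a Plancherel bound\<close>

definition char_fun :: "'a::euclidean_space measure \<Rightarrow> 'a \<Rightarrow> complex" where
  "char_fun M z = (CLINT y|M. cis (z \<bullet> y))"

lemma norm_char_fun_le:
  assumes "prob_space M"
  shows "norm (char_fun M z) \<le> 1"
proof -
  interpret prob_space M by fact
  have "norm (char_fun M z) \<le> (\<integral>y. norm (cis (z \<bullet> y)) \<partial>M)"
    unfolding char_fun_def by (rule integral_norm_bound)
  then show ?thesis by (simp add: prob_space)
qed

lemma char_fun_measurable:
  assumes "prob_space M" "sets M = sets borel"
  shows "char_fun M \<in> borel_measurable borel"
proof -
  interpret prob_space M by fact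
  note assms(2)[measurable_cong]
  show ?thesis unfolding char_fun_def[abs_def] by measurable
qed

text \<open>Fubini, which the Gaussian factor permits for every probability measure. The right-hand
  side is, up to \<open>(2 * pi) ^ d\<close>, the density at \<open>x\<close> of \<open>M\<close>
  convolved with a normal law.\<close>

lemma gaussian_smoothing:
  fixes M :: "'a::euclidean_space measure"
  assumes M: "prob_space M" "sets M = sets borel" and \<sigma>: "\<sigma> > 0"
  shows "(CLINT z|lborel. cis (- (z \<bullet> x)) * char_fun M z * of_real (exp (- (\<sigma> * norm z)\<^sup>2 / 2)))
     = of_real ((2 * pi) ^ DIM('a) * (\<integral>y. gauss_density \<sigma> (y - x) \<partial>M))"
proof -
  interpret M: prob_space M by fact
  interpret P: pair_sigma_finite lborel M ..
  note M(2)[measurable_cong]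
  let ?g = "\<lambda>z::'a. exp (- (\<sigma> * norm z)\<^sup>2 / 2)"
  let ?f = "\<lambda>z y. cis (z \<bullet> (y - x)) * of_real (?g z)"
  have g: "integrable lborel ?g"
    using gaussian_fourier[OF \<sigma>, of "0::'a"] integrable_Re[of lborel "\<lambda>z::'a. of_real (?g z)"]
    by (simp add: has_bochner_integral_iff)
  have int: "integrable (lborel \<Otimes>\<^sub>M M) (case_prod ?f)"
  proof (rule P.Fubini_integrable)
    show "integrable lborel (\<lambda>z. LINT y|M. norm (case (z, y) of (z, y) \<Rightarrow> ?f z y))"
      using g by (simp add: norm_mult M.prob_space)
    have "integrable M (\<lambda>y. cis (z \<bullet> (y - x)) * of_real (?g z))" for z
      by (intro integrable_mult_left M.integrable_const_bound[where B=1]) auto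
    then show "AE z in lborel. integrable M (\<lambda>y. case (z, y) of (z, y) \<Rightarrow> ?f z y)"
      by simp
  qed measurable
  have "(CLINT z|lborel. cis (- (z \<bullet> x)) * char_fun M z * of_real (?g z)) = (CLINT z|lborel. CLINT y|M. ?f z y)"
  proof (intro Bochner_Integration.integral_cong refl)
    fix z :: 'a
    have "integrable M (\<lambda>y. cis (z \<bullet> y))"
      by (intro M.integrable_const_bound[where B=1]) auto
    then have "cis (- (z \<bullet> x)) * char_fun M z * of_real (?g z)
        = (CLINT y|M. cis (- (z \<bullet> x)) * cis (z \<bullet> y) * of_real (?g z))"
      by (simp add: char_fun_def)
    then show "cis (- (z \<bullet> x)) * char_fun M z * of_real (?g z) = (CLINT y|M. ?f z y)"
      by (simp add: cis_mult inner_diff_right)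
  qed
  also have "\<dots> = (CLINT y|M. CLINT z|lborel. ?f z y)"
    using P.Fubini_integral[OF int] by simp
  also have "\<dots> = (CLINT y|M. of_real ((2 * pi) ^ DIM('a) * gauss_density \<sigma> (y - x)))"
    using gaussian_fourier[OF \<sigma>, where 'a='a, unfolded has_bochner_integral_iff] by simp
  also have "\<dots> = of_real ((2 * pi) ^ DIM('a) * (\<integral>y. gauss_density \<sigma> (y - x) \<partial>M))"
    by (simp del: of_real_mult)
  finally show ?thesis .
qed

lemma gauss_density_integral_translate:
  assumes "\<sigma> > 0"
  shows "has_bochner_integral lborel (\<lambda>y. gauss_density \<sigma> (y - x :: 'a::euclidean_space)) 1"
proof -
  have "has_bochner_integral (distr lborel borel ((+) x)) (\<lambda>y. gauss_density \<sigma> (y - x)) 1"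
    using gauss_density_integral[OF assms, where 'a='a]
    by (intro has_bochner_integral_distr) auto
  then show ?thesis by (simp add: lborel_distr_plus)
qed

lemma gauss_density_integrable:
  fixes M :: "'a::euclidean_space measure"
  assumes "prob_space M" "sets M = sets borel" "\<sigma> > 0"
  shows "integrable M (\<lambda>y. gauss_density \<sigma> (y - x))"
proof -
  interpret prob_space M by fact
  note assms(2)[measurable_cong]
  show ?thesis
    using assms(3)
    by (intro integrable_const_bound[where B="1 / (sqrt (2 * pi) * \<sigma>) ^ DIM('a)"])
       (auto simp: gauss_density_def intro!: divide_right_mono)
qed

text \<open>The squared modulus is \<open>char_fun M z\<close> times its conjugate, and the
  conjugate is itself an integral over \<open>M\<close>. Exchanging integrals leaves the smoothed
  density \<open>?q\<close> integrated against \<open>M\<close>; as an average of \<open>p\<close>,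
  it is at most \<open>B\<close>.\<close>

lemma nn_integral_char_fun_sq_gauss_le:
  fixes M :: "'a::euclidean_space measure"
  assumes M: "prob_space M" "M = density lborel (\<lambda>x. ennreal (p x))"
    and p[measurable]: "p \<in> borel_measurable borel"
    and p_nonneg: "\<And>x. 0 \<le> p x" and p_le: "\<And>x. p x \<le> B" and \<sigma>: "\<sigma> > 0"
  shows "(\<integral>\<^sup>+z. ennreal ((norm (char_fun M z))\<^sup>2 * exp (- (\<sigma> * norm z)\<^sup>2 / 2)) \<partial>lborel)
     \<le> ennreal ((2 * pi) ^ DIM('a) * B)"
proof -
  interpret M: prob_space M by fact
  interpret P: pair_sigma_finite lborel M ..
  have sets_M[measurable_cong]: "sets M = sets borel" by (simp add: M(2))
  note [measurable] = char_fun_measurable[OF M(1) sets_M]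
  let ?g = "\<lambda>z::'a. exp (- (\<sigma> * norm z)\<^sup>2 / 2)"
  let ?q = "\<lambda>x. \<integral>y. gauss_density \<sigma> (y - x) \<partial>M"
  let ?f = "\<lambda>z x. cis (- (z \<bullet> x)) * char_fun M z * of_real (?g z)"
  have g: "integrable lborel ?g"
    using gaussian_fourier[OF \<sigma>, of "0::'a"] integrable_Re[of lborel "\<lambda>z::'a. of_real (?g z)"]
    by (simp add: has_bochner_integral_iff)
  have q_le: "?q x \<le> B" for x
  proof -
    have "?q x = (\<integral>y. p y * gauss_density \<sigma> (y - x) \<partial>lborel)"
      by (subst M(2), subst integral_density) (auto simp: p_nonneg)
    also have "\<dots> \<le> (\<integral>y. B * gauss_density \<sigma> (y - x) \<partial>lborel)"
    proof (rule integral_mono)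
      show i: "integrable lborel (\<lambda>y. B * gauss_density \<sigma> (y - x))"
        using gauss_density_integral_translate[OF \<sigma>, of x] by (auto simp: has_bochner_integral_iff)
      show le: "p y * gauss_density \<sigma> (y - x) \<le> B * gauss_density \<sigma> (y - x)" for y
        using p_le \<sigma> by (intro mult_right_mono) auto
      show "integrable lborel (\<lambda>y. p y * gauss_density \<sigma> (y - x))"
        by (rule Bochner_Integration.integrable_bound[OF i]) 
           (use le p_nonneg \<sigma> order_trans[OF p_nonneg p_le] in \<open>auto simp: abs_mult\<close>)
    qed
    also have "\<dots> = B"
      using gauss_density_integral_translate[OF \<sigma>, of x] by (auto simp: has_bochner_integral_iff)
    finally show ?thesis .
  qed
  have sq_le1: "(norm (char_fun M z))\<^sup>2 \<le> 1" for z
    using norm_char_fun_le[OF M(1), of z] by (simp add: power_le_one)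
  have sq_int: "integrable lborel (\<lambda>z. (norm (char_fun M z))\<^sup>2 * ?g z)"
    by (rule Bochner_Integration.integrable_bound[OF g])
       (auto intro!: AE_I2 mult_left_le_one_le sq_le1)
  have "(CLINT z|lborel. of_real ((norm (char_fun M z))\<^sup>2 * ?g z)) = (CLINT z|lborel. CLINT x|M. ?f z x)"
  proof (intro Bochner_Integration.integral_cong refl)
    fix z :: 'a
    have i: "integrable M (\<lambda>y. cis (z \<bullet> y))" for z
      by (intro M.integrable_const_bound[where B=1]) auto
    have "(CLINT x|M. ?f z x) = (CLINT x|M. cis (- (z \<bullet> x))) * char_fun M z * of_real (?g z)"
      using i[of "-z"] by simp
    also have "(CLINT x|M. cis (- (z \<bullet> x))) = cnj (char_fun M z)"
      unfolding char_fun_def by (subst Bochner_Integration.integral_cnj[symmetric]) (simp add: cis_cnj)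
    finally show "of_real ((norm (char_fun M z))\<^sup>2 * ?g z) = (CLINT x|M. ?f z x)"
      by (auto simp: complex_norm_square mult_ac simp del: of_real_power)
  qed
  also have "\<dots> = (CLINT x|M. CLINT z|lborel. ?f z x)"
  proof (rule P.Fubini_integral[symmetric], rule P.Fubini_integrable)
    have "integrable lborel (\<lambda>z. norm (char_fun M z) * ?g z)"
      by (rule Bochner_Integration.integrable_bound[OF g])
         (auto intro!: AE_I2 mult_left_le_one_le norm_char_fun_le[OF M(1)])
    then show "integrable lborel (\<lambda>z. LINT x|M. norm (case (z, x) of (z, x) \<Rightarrow> ?f z x))"
      by (simp add: norm_mult M.prob_space)
    have "integrable M (\<lambda>x. ?f z x)" for z
      by (intro integrable_mult_left M.integrable_const_bound[where B=1]) auto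
    then show "AE z in lborel. integrable M (\<lambda>x. case (z, x) of (z, x) \<Rightarrow> ?f z x)"
      by simp
  qed measurable
  also have "\<dots> = of_real (\<integral>x. (2 * pi) ^ DIM('a) * ?q x \<partial>M)"
    by (subst gaussian_smoothing[OF M(1) sets_M \<sigma>]) (rule integral_complex_of_real)
  finally have "of_real (\<integral>z. (norm (char_fun M z))\<^sup>2 * ?g z \<partial>lborel) = complex_of_real (\<integral>x. (2 * pi) ^ DIM('a) * ?q x \<partial>M)"
    by (subst (asm) integral_complex_of_real)
  then have "(\<integral>z. (norm (char_fun M z))\<^sup>2 * ?g z \<partial>lborel) = (\<integral>x. (2 * pi) ^ DIM('a) * ?q x \<partial>M)"
    by (simp only: of_real_eq_iff)
  also have "\<dots> \<le> (\<integral>x. (2 * pi) ^ DIM('a) * B \<partial>M)"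
    by (intro integral_mono M.integrable_const_bound[where B="(2 * pi) ^ DIM('a) * B"] AE_I2 mult_left_mono q_le)
       (use q_le \<sigma> order_trans[OF p_nonneg p_le] in \<open>auto simp: abs_mult intro!: mult_left_mono\<close>)
  also have "\<dots> = (2 * pi) ^ DIM('a) * B"
    by (simp add: M.prob_space)
  finally show ?thesis
    by (subst nn_integral_eq_integral[OF sq_int]) (auto intro: ennreal_leI)
qed

text \<open>Fatou's lemma as the Gaussian width parameter tends to 0; the bound of the smoothed
  version does not depend on it.\<close>

lemma nn_integral_char_fun_sq_le:
  fixes M :: "'a::euclidean_space measure"
  assumes M: "prob_space M" "M = density lborel (\<lambda>x. ennreal (p x))"
    and p[measurable]: "p \<in> borel_measurable borel"
    and p_nonneg: "\<And>x. 0 \<le> p x" and p_le: "\<And>x. p x \<le> B"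
  shows "(\<integral>\<^sup>+z. ennreal ((norm (char_fun M z))\<^sup>2) \<partial>lborel) \<le> ennreal ((2 * pi) ^ DIM('a) * B)"
proof -
  have sets_M: "sets M = sets borel" by (simp add: M(2))
  note [measurable] = char_fun_measurable[OF M(1) sets_M]
  define \<sigma> where "\<sigma> n = 1 / real (Suc n)" for n
  have \<sigma>0: "\<sigma> \<longlonglongrightarrow> 0"
    unfolding \<sigma>_def by (rule LIMSEQ_Suc[OF lim_1_over_n])
  have lim: "(\<lambda>n. ennreal ((norm (char_fun M z))\<^sup>2 * exp (- (\<sigma> n * norm z)\<^sup>2 / 2))) \<longlonglongrightarrow> ennreal ((norm (char_fun M z))\<^sup>2)" for z
  proof -
    have "(\<lambda>n. (norm (char_fun M z))\<^sup>2 * exp (- (\<sigma> n * norm z)\<^sup>2 / 2)) \<longlonglongrightarrow> (norm (char_fun M z))\<^sup>2 * exp (- (0 * norm z)\<^sup>2 / 2)"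
      by (intro tendsto_intros \<sigma>0) auto
    then show ?thesis by (auto intro: tendsto_ennrealI)
  qed
  have "(\<integral>\<^sup>+z. ennreal ((norm (char_fun M z))\<^sup>2) \<partial>lborel)
      = (\<integral>\<^sup>+z. liminf (\<lambda>n. ennreal ((norm (char_fun M z))\<^sup>2 * exp (- (\<sigma> n * norm z)\<^sup>2 / 2))) \<partial>lborel)"
    using lim by (intro nn_integral_cong) (metis lim_imp_Liminf sequentially_bot)
  also have "\<dots> \<le> liminf (\<lambda>n. \<integral>\<^sup>+z. ennreal ((norm (char_fun M z))\<^sup>2 * exp (- (\<sigma> n * norm z)\<^sup>2 / 2)) \<partial>lborel)"
    by (rule nn_integral_liminf) measurable
  also have "\<dots> \<le> liminf (\<lambda>n. ennreal ((2 * pi) ^ DIM('a) * B))"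
    by (intro Liminf_mono always_eventually allI nn_integral_char_fun_sq_gauss_le[OF M p p_nonneg p_le])
       (simp add: \<sigma>_def)
  also have "\<dots> = ennreal ((2 * pi) ^ DIM('a) * B)"
    by (intro Liminf_const) simp
  finally show ?thesis .
qed

section \<open>Fourier inversion\<close>

text \<open>Substituting \<open>x = y - \<sigma> w\<close> moves \<open>\<sigma>\<close> out of the
  kernel, which then serves as one dominating function for all \<open>\<sigma>\<close>.\<close>

lemma nn_integral_gauss_convolution:
  fixes y :: "'a::euclidean_space"
  assumes [measurable]: "f \<in> borel_measurable borel" and "\<sigma> > 0"
  shows "(\<integral>\<^sup>+x. f x * ennreal (gauss_density \<sigma> (y - x)) \<partial>lborel)
    = (\<integral>\<^sup>+w. f (y - \<sigma> *\<^sub>R w) * ennreal (gauss_density 1 w) \<partial>lborel)"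
proof -
  have eq: "\<sigma> ^ DIM('a) * gauss_density \<sigma> (\<sigma> *\<^sub>R w) = gauss_density 1 w" for w :: 'a
    using assms(2) by (simp add: gauss_density_def power_mult_distrib)
  have "(\<integral>\<^sup>+x. f x * ennreal (gauss_density \<sigma> (y - x)) \<partial>lborel)
     = (\<integral>\<^sup>+w. ennreal (\<sigma> ^ DIM('a)) * (f (y - \<sigma> *\<^sub>R w) * ennreal (gauss_density \<sigma> (\<sigma> *\<^sub>R w))) \<partial>lborel)"
    using assms(2)
    by (subst lborel_affine[of "- \<sigma>" y]) (auto simp: nn_integral_density nn_integral_distr)
  also have "\<dots> = (\<integral>\<^sup>+w. f (y - \<sigma> *\<^sub>R w) * ennreal (gauss_density 1 w) \<partial>lborel)"
    using assms(2)
    by (intro nn_integral_cong) (auto simp: eq[symmetric] ennreal_mult mult_ac)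
  finally show ?thesis .
qed

lemma nn_integral_gauss_density_1: "(\<integral>\<^sup>+w. ennreal (gauss_density 1 w) \<partial>(lborel::'a::euclidean_space measure)) = 1"
  using gauss_density_integral[of 1, where 'a='a]
  by (subst nn_integral_eq_integral) (auto simp: has_bochner_integral_iff)

text \<open>Open boxes are bounded, closed under intersection, generate the Borel sets and exhaust
  the space.\<close>

lemma borel_measure_eqI_bounded_open:
  fixes M N :: "'a::euclidean_space measure"
  assumes "sets M = sets borel" "sets N = sets borel" "finite_measure M"
    and eq: "\<And>U. open U \<Longrightarrow> bounded U \<Longrightarrow> emeasure M U = emeasure N U"
  shows "M = N"
proof (rule measure_eqI_generator_eq)
  interpret finite_measure M by fact
  let ?E = "range (\<lambda>(a, b). box a b::'a set)"
  show "Int_stable ?E"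
    by (auto simp: Int_stable_def box_Int_box)
  show "?E \<subseteq> Pow UNIV" "sets M = sigma_sets UNIV ?E" "sets N = sigma_sets UNIV ?E"
    using assms(1,2) by (simp_all add: borel_eq_box)
  let ?A = "\<lambda>n::nat. box (- (real n *\<^sub>R One)) (real n *\<^sub>R One) :: 'a set"
  show "range ?A \<subseteq> ?E" "(\<Union>i. ?A i) = UNIV"
    unfolding UN_box_eq_UNIV by auto
  show "emeasure M (?A i) \<noteq> \<infinity>" for i by simp
  show "emeasure M X = emeasure N X" if "X \<in> ?E" for X
    using that by (auto intro!: eq open_box bounded_box)
qed

text \<open>The densities \<open>q n\<close> of the Gaussian-smoothed measures are nonnegative,
  bounded by \<open>K\<close>, and converge pointwise to the inversion integral \<open>p\<close> by
  dominated convergence. It remains to identify \<open>M\<close>, first on continuous functions of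
  bounded support and then on bounded open sets.\<close>

lemma density_of_integrable_char_fun:
  fixes M :: "'a::euclidean_space measure"
  assumes M: "prob_space M" and sets_M: "sets M = sets borel"
    and int: "integrable lborel (char_fun M)"
  obtains p where "p \<in> borel_measurable borel" "\<And>x. 0 \<le> p x"
    "\<And>x. p x \<le> (\<integral>z. norm (char_fun M z) \<partial>lborel) / (2 * pi) ^ DIM('a)"
    "M = density lborel (\<lambda>x. ennreal (p x))"
proof -
  interpret M: prob_space M by fact
  interpret P: pair_sigma_finite lborel M ..
  note sets_M[measurable_cong]
  note [measurable] = char_fun_measurable[OF M(1) sets_M]
  define \<sigma> where "\<sigma> n = 1 / real (Suc n)" for n
  have \<sigma>_pos: "\<sigma> n > 0" for n by (simp add: \<sigma>_def)
  have \<sigma>0: "\<sigma> \<longlonglongrightarrow> 0"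
    unfolding \<sigma>_def by (rule LIMSEQ_Suc[OF lim_1_over_n])
  define D :: real where "D = (2 * pi) ^ DIM('a)"
  have D: "D > 0" by (simp add: D_def)
  define K where "K = (\<integral>z. norm (char_fun M z) \<partial>lborel) / D"
  \<comment> \<open>Taking the real part makes \<open>p\<close> real from the start; its sign and
    its bound are inherited from the \<open>q n\<close> in the limit.\<close>
  define p where "p x = Re (CLINT z|lborel. cis (- (z \<bullet> x)) * char_fun M z) / D" for x
  define q where "q n x = (\<integral>y. gauss_density (\<sigma> n) (y - x) \<partial>M)" for n x
  have q_eq: "q n x = Re (CLINT z|lborel. cis (- (z \<bullet> x)) * char_fun M z * of_real (exp (- (\<sigma> n * norm z)\<^sup>2 / 2))) / D" for n x
    unfolding gaussian_smoothing[OF M sets_M \<sigma>_pos] q_def[symmetric] D_def[symmetric]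
    using D by simp
  have q_nonneg: "0 \<le> q n x" for n x
    unfolding q_def using \<sigma>_pos by auto
  have q_le: "q n x \<le> K" for n x
  proof -
    let ?f = "\<lambda>z. cis (- (z \<bullet> x)) * char_fun M z * of_real (exp (- (\<sigma> n * norm z)\<^sup>2 / 2))"
    have le: "norm (?f z) \<le> norm (char_fun M z)" for z
      by (simp add: norm_mult mult_left_le)
    have i: "integrable lborel ?f"
      by (rule Bochner_Integration.integrable_bound[OF int _ AE_I2[OF le]]) measurable
    have "Re (CLINT z|lborel. ?f z) \<le> norm (CLINT z|lborel. ?f z)" by (rule complex_Re_le_cmod)
    also have "\<dots> \<le> (\<integral>z. norm (?f z) \<partial>lborel)" by (rule integral_norm_bound)
    also have "\<dots> \<le> (\<integral>z. norm (char_fun M z) \<partial>lborel)"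
      by (rule integral_mono[OF integrable_norm[OF i] integrable_norm[OF int] le])
    finally show ?thesis unfolding q_eq K_def using D by (intro divide_right_mono) auto
  qed
  have q_lim: "(\<lambda>n. q n x) \<longlonglongrightarrow> p x" for x
  proof -
    have "(\<lambda>n. CLINT z|lborel. cis (- (z \<bullet> x)) * char_fun M z * of_real (exp (- (\<sigma> n * norm z)\<^sup>2 / 2)))
      \<longlonglongrightarrow> (CLINT z|lborel. cis (- (z \<bullet> x)) * char_fun M z)"
    proof (rule integral_dominated_convergence[where w="\<lambda>z. norm (char_fun M z)"], goal_cases)
      case 4
      show ?case
      proof (rule AE_I2)
        fix z :: 'a
        have "(\<lambda>n. cis (- (z \<bullet> x)) * char_fun M z * of_real (exp (- (\<sigma> n * norm z)\<^sup>2 / 2)))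
            \<longlonglongrightarrow> cis (- (z \<bullet> x)) * char_fun M z * of_real (exp (- (0 * norm z)\<^sup>2 / 2))"
          by (intro tendsto_intros \<sigma>0) auto
        then show "(\<lambda>n. cis (- (z \<bullet> x)) * char_fun M z * of_real (exp (- (\<sigma> n * norm z)\<^sup>2 / 2)))
            \<longlonglongrightarrow> cis (- (z \<bullet> x)) * char_fun M z" by simp
      qed
    next
      case (5 n)
      show ?case
      proof (rule AE_I2)
        fix z show "norm (cis (- (z \<bullet> x)) * char_fun M z * of_real (exp (- (\<sigma> n * norm z)\<^sup>2 / 2))) \<le> norm (char_fun M z)"
          by (simp add: norm_mult mult_left_le)
      qed
    qed (use int in auto)
    then show ?thesis
      unfolding p_def q_eq using D by (intro tendsto_intros) auto
  qed
  have p_nonneg: "0 \<le> p x" for x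
    by (rule LIMSEQ_le_const[OF q_lim]) (use q_nonneg in auto)
  have p_le: "p x \<le> K" for x
    by (rule LIMSEQ_le_const2[OF q_lim]) (use q_le in auto)
  have p_meas[measurable]: "p \<in> borel_measurable borel"
    unfolding p_def[abs_def] by measurable
  have q_meas[measurable]: "q n \<in> borel_measurable borel" for n
    unfolding q_def[abs_def] by measurable

  \<comment> \<open>The integrals of \<open>f * q n\<close> are computed as a limit in two ways.
    Boundedness of \<open>S\<close> provides the dominating function \<open>K * indicator S\<close>
    on the Lebesgue side.\<close>
  have test: "(\<integral>\<^sup>+x. ennreal (f x) \<partial>M) = (\<integral>\<^sup>+x. ennreal (f x * p x) \<partial>lborel)"
    if cont: "continuous_on UNIV f" and f0: "\<And>x. 0 \<le> f x" and f1: "\<And>x. f x \<le> 1"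
      and supp: "\<And>x. x \<notin> S \<Longrightarrow> f x = 0" and S: "bounded S" "open S" for f S
  proof -
    have [measurable]: "f \<in> borel_measurable borel"
      by (rule borel_measurable_continuous_onI[OF cont])
    have [measurable]: "S \<in> sets borel" using S by simp
    let ?I = "\<lambda>n. \<integral>\<^sup>+x. ennreal (f x * q n x) \<partial>lborel"
    have "?I \<longlonglongrightarrow> (\<integral>\<^sup>+x. ennreal (f x * p x) \<partial>lborel)"
    proof (rule nn_integral_dominated_convergence[where w="\<lambda>x. ennreal K * indicator S x"])
      show "AE x in lborel. ennreal (f x * q j x) \<le> ennreal K * indicator S x" for j
      proof (rule AE_I2)
        fix x show "ennreal (f x * q j x) \<le> ennreal K * indicator S x"
          using supp[of x] q_le[of j x] q_nonneg[of j x] f0[of x] f1[of x] mult_mono[of "f x" 1 "q j x" K]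
          by (cases "x \<in> S") (auto intro!: ennreal_leI)
      qed
      show "(\<integral>\<^sup>+x. ennreal K * indicator S x \<partial>lborel) < \<infinity>"
        using emeasure_bounded_finite[OF S(1)]
        by (subst nn_integral_cmult_indicator) (auto simp: ennreal_mult_less_top)
      show "AE x in lborel. (\<lambda>i. ennreal (f x * q i x)) \<longlonglongrightarrow> ennreal (f x * p x)"
        by (intro AE_I2 tendsto_ennrealI tendsto_intros q_lim)
    qed auto
    moreover have "?I \<longlonglongrightarrow> (\<integral>\<^sup>+x. ennreal (f x) \<partial>M)"
    proof -
      \<comment> \<open>By Fubini the smoothing passes from \<open>M\<close> to \<open>f\<close>:
        \<open>c n\<close> is \<open>f\<close> convolved with a Gaussian, stays below 1 and tends to
        \<open>f\<close> by continuity.\<close>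
      define c where "c n y = (\<integral>\<^sup>+w. ennreal (f (y - \<sigma> n *\<^sub>R w)) * ennreal (gauss_density 1 w) \<partial>lborel)" for n and y :: 'a
      have [measurable]: "c n \<in> borel_measurable borel" for n
        unfolding c_def[abs_def] by measurable
      have I_eq: "?I n = (\<integral>\<^sup>+y. c n y \<partial>M)" for n
      proof -
        have "ennreal (f x * q n x) = (\<integral>\<^sup>+y. ennreal (f x) * ennreal (gauss_density (\<sigma> n) (y - x)) \<partial>M)" for x
          unfolding q_def using f0 \<sigma>_pos[of n]
          by (subst nn_integral_cmult, simp, subst nn_integral_eq_integral[OF gauss_density_integrable[OF M sets_M]])
             (auto simp: ennreal_mult)
        then have "?I n = (\<integral>\<^sup>+x. \<integral>\<^sup>+y. ennreal (f x) * ennreal (gauss_density (\<sigma> n) (y - x)) \<partial>M \<partial>lborel)"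
          by simp
        also have "\<dots> = (\<integral>\<^sup>+y. \<integral>\<^sup>+x. ennreal (f x) * ennreal (gauss_density (\<sigma> n) (y - x)) \<partial>lborel \<partial>M)"
          by (rule P.Fubini'[symmetric]) measurable
        also have "\<dots> = (\<integral>\<^sup>+y. c n y \<partial>M)"
          unfolding c_def by (subst nn_integral_gauss_convolution[OF _ \<sigma>_pos]) auto
        finally show ?thesis .
      qed
      have c_le: "c n y \<le> 1" for n y
      proof -
        have "c n y \<le> (\<integral>\<^sup>+w. ennreal (gauss_density 1 w) \<partial>(lborel :: 'a measure))"
          unfolding c_def using f1 f0
          by (intro nn_integral_mono) (auto simp: ennreal_mult[symmetric] mult_left_le_one_le intro!: ennreal_leI)
        then show ?thesis by (simp add: nn_integral_gauss_density_1)
      qed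
      have c_lim: "(\<lambda>n. c n y) \<longlonglongrightarrow> ennreal (f y)" for y
      proof -
        have "(\<lambda>n. c n y) \<longlonglongrightarrow> (\<integral>\<^sup>+w. ennreal (f y) * ennreal (gauss_density 1 w) \<partial>(lborel :: 'a measure))"
          unfolding c_def
        proof (rule nn_integral_dominated_convergence[where w="\<lambda>w. ennreal (gauss_density 1 w)"])
          show "AE w in lborel. ennreal (f (y - \<sigma> j *\<^sub>R w)) * ennreal (gauss_density 1 w) \<le> ennreal (gauss_density 1 w)" for j
            using f1 f0 by (intro AE_I2) (auto simp: ennreal_mult[symmetric] mult_left_le_one_le intro!: ennreal_leI)
          show "AE w in lborel. (\<lambda>i. ennreal (f (y - \<sigma> i *\<^sub>R w)) * ennreal (gauss_density 1 w)) \<longlonglongrightarrow> ennreal (f y) * ennreal (gauss_density 1 w)"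
          proof (rule AE_I2)
            fix w :: 'a
            have "(\<lambda>i. y - \<sigma> i *\<^sub>R w) \<longlonglongrightarrow> y - 0 *\<^sub>R w"
              by (intro tendsto_intros \<sigma>0)
            then have "(\<lambda>i. f (y - \<sigma> i *\<^sub>R w)) \<longlonglongrightarrow> f y"
              using cont by (intro isCont_tendsto_compose[of y f]) (auto simp: continuous_on_eq_continuous_at)
            then have "(\<lambda>i. ennreal (f (y - \<sigma> i *\<^sub>R w) * gauss_density 1 w)) \<longlonglongrightarrow> ennreal (f y * gauss_density 1 w)"
              by (intro tendsto_ennrealI tendsto_intros)
            then show "(\<lambda>i. ennreal (f (y - \<sigma> i *\<^sub>R w)) * ennreal (gauss_density 1 w)) \<longlonglongrightarrow> ennreal (f y) * ennreal (gauss_density 1 w)"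
              by (simp add: ennreal_mult f0)
          qed
        qed (auto simp: nn_integral_gauss_density_1)
        then show ?thesis
          by (simp add: nn_integral_cmult nn_integral_gauss_density_1)
      qed
      show ?thesis
        unfolding I_eq
        by (rule nn_integral_dominated_convergence[where w="\<lambda>_. 1"])
           (auto simp: c_le c_lim M.emeasure_space_1)
    qed
    ultimately show ?thesis using LIMSEQ_unique by blast
  qed

  have "M = density lborel (\<lambda>x. ennreal (p x))"
  proof (rule borel_measure_eqI_bounded_open)
    show "finite_measure M" by (rule M.finite_measure_axioms)
    fix U :: "'a set" assume U: "open U" "bounded U"
    \<comment> \<open>\<open>infdist\<close> to the empty set is 0 by convention, so the cut-off
      functions below need a nonempty complement.\<close>
    have ne: "- U \<noteq> {}"
      using U(2) not_bounded_UNIV[where 'a='a] by (metis double_compl compl_bot_eq)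
    have [measurable]: "U \<in> sets borel" using U by simp
    \<comment> \<open>Continuous cut-offs that vanish off \<open>U\<close> and tend to its
      indicator, because points of the open set \<open>U\<close> have positive distance to the
      complement.\<close>
    define f where "f n x = min 1 (real n * infdist x (- U))" for n x
    have cont: "continuous_on UNIV (f n)" for n
      unfolding f_def by (intro continuous_intros)
    have [measurable]: "f n \<in> borel_measurable borel" for n
      by (rule borel_measurable_continuous_onI[OF cont])
    have f0: "0 \<le> f n x" and f1: "f n x \<le> 1" for n x
      unfolding f_def by (auto simp: infdist_nonneg)
    have f_out: "f n x = 0" if "x \<notin> U" for n x
      using that by (simp add: f_def infdist_zero)
    have f_lim: "(\<lambda>n. f n x) \<longlonglongrightarrow> indicator U x" for x
    proof (cases "x \<in> U")
      case True
      then have "infdist x (- U) > 0"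
        using in_closed_iff_infdist_zero[of "- U" x] U ne infdist_nonneg[of x "- U"] by (auto simp: less_le)
      then obtain n0 where "real n0 * infdist x (- U) > 1"
        using reals_Archimedean3 by blast
      then have "eventually (\<lambda>n. f n x = 1) sequentially"
        using infdist_nonneg[of x "- U"]
        by (intro eventually_sequentiallyI[of n0])
           (auto simp: f_def min_def dest!: mult_right_mono[of "real n0" _ "infdist x (- U)", OF of_nat_mono])
      then show ?thesis using True by (auto intro: tendsto_eventually)
    qed (simp add: f_out)
    have "(\<lambda>n. \<integral>\<^sup>+x. ennreal (f n x) \<partial>M) \<longlonglongrightarrow> (\<integral>\<^sup>+x. indicator U x \<partial>M)"
    proof (rule nn_integral_dominated_convergence[where w="\<lambda>_. 1"])
      show "AE x in M. (\<lambda>i. ennreal (f i x)) \<longlonglongrightarrow> indicator U x"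
        using tendsto_ennrealI[OF f_lim] by (auto simp: ennreal_indicator)
    qed (auto simp: f1 M.emeasure_space_1)
    moreover have "(\<lambda>n. \<integral>\<^sup>+x. ennreal (f n x * p x) \<partial>lborel) \<longlonglongrightarrow> (\<integral>\<^sup>+x. ennreal (p x) * indicator U x \<partial>lborel)"
    proof (rule nn_integral_dominated_convergence[where w="\<lambda>x. ennreal K * indicator U x"])
      show "AE x in lborel. ennreal (f j x * p x) \<le> ennreal K * indicator U x" for j
      proof (rule AE_I2)
        fix x show "ennreal (f j x * p x) \<le> ennreal K * indicator U x"
          using f_out[of x j] p_le[of x] p_nonneg[of x] f0[of j x] f1[of j x] mult_mono[of "f j x" 1 "p x" K]
          by (cases "x \<in> U") (auto intro!: ennreal_leI)
      qed
      show "(\<integral>\<^sup>+x. ennreal K * indicator U x \<partial>lborel) < \<infinity>"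
        using emeasure_bounded_finite[OF U(2)]
        by (subst nn_integral_cmult_indicator) (auto simp: ennreal_mult_less_top)
      show "AE x in lborel. (\<lambda>i. ennreal (f i x * p x)) \<longlonglongrightarrow> ennreal (p x) * indicator U x"
      proof (rule AE_I2)
        fix x
        have "(\<lambda>i. ennreal (f i x * p x)) \<longlonglongrightarrow> ennreal (indicator U x * p x)"
          by (intro tendsto_ennrealI tendsto_intros f_lim)
        then show "(\<lambda>i. ennreal (f i x * p x)) \<longlonglongrightarrow> ennreal (p x) * indicator U x"
          by (cases "x \<in> U") auto
      qed
    qed auto
    moreover have "(\<integral>\<^sup>+x. ennreal (f n x) \<partial>M) = (\<integral>\<^sup>+x. ennreal (f n x * p x) \<partial>lborel)" for n
      by (rule test[OF cont f0 f1 f_out U(2,1)])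
    ultimately have "(\<integral>\<^sup>+x. indicator U x \<partial>M) = (\<integral>\<^sup>+x. ennreal (p x) * indicator U x \<partial>lborel)"
      using LIMSEQ_unique by fastforce
    then show "emeasure M U = emeasure (density lborel (\<lambda>x. ennreal (p x))) U"
      by (simp add: emeasure_density)
  qed (auto simp: sets_M)
  with that[OF p_meas p_nonneg] p_le show ?thesis
    unfolding K_def D_def by blast
qed

section \<open>Elementary inequalities\<close>

lemma one_minus_cos_eq: "1 - cos u = 2 * (sin (u / 2))\<^sup>2" for u :: real
  using cos_double_sin[of "u/2"] by simp

lemma one_minus_cos_le: "1 - cos u \<le> 2 * min 1 (u\<^sup>2 / 4)" for u :: real
proof -
  have "(sin (u / 2))\<^sup>2 \<le> (u / 2)\<^sup>2"
    using abs_sin_x_le_abs_x[of "u/2"] by (subst abs_le_square_iff[symmetric])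
  moreover have "(sin (u / 2))\<^sup>2 \<le> 1"
    by (simp add: abs_square_le_1)
  ultimately show ?thesis by (auto simp: one_minus_cos_eq power_divide)
qed

text \<open>At half angles \<open>1 - cos\<close> is twice a squared sine, and \<open>|sin|\<close>
  is subadditive; squaring the sum costs the factor 2.\<close>

lemma one_minus_cos_add_le: "1 - cos (u + v) \<le> 2 * (1 - cos u) + 2 * (1 - cos v)" for u v :: real
proof -
  let ?p = "u / 2" and ?q = "v / 2"
  have "\<bar>sin ?p * cos ?q\<bar> \<le> \<bar>sin ?p\<bar>" "\<bar>cos ?p * sin ?q\<bar> \<le> \<bar>sin ?q\<bar>"
    by (auto simp: abs_mult mult_left_le mult_right_le_one_le mult_left_le_one_le)
  then have "\<bar>sin (?p + ?q)\<bar> \<le> \<bar>sin ?p\<bar> + \<bar>sin ?q\<bar>"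
    unfolding sin_add by linarith
  then have "(sin (?p + ?q))\<^sup>2 \<le> (\<bar>sin ?p\<bar> + \<bar>sin ?q\<bar>)\<^sup>2"
    by (metis abs_ge_zero power2_abs power_mono)
  also have "\<dots> \<le> 2 * (sin ?p)\<^sup>2 + 2 * (sin ?q)\<^sup>2"
    using zero_le_power2[of "\<bar>sin ?p\<bar> - \<bar>sin ?q\<bar>"] by (simp add: power2_sum power2_diff)
  finally show ?thesis
    by (simp add: one_minus_cos_eq add_divide_distrib)
qed

lemma sin_cubic_bounds:
  fixes y :: real assumes "0 \<le> y"
  shows "sin y \<le> y - y ^ 3 / 6 + y ^ 4 / 24" "y - y ^ 3 / 6 - y ^ 4 / 24 \<le> sin y"
proof -
  have "(\<Sum>m<4. sin_coeff m * y ^ m) = y - y ^ 3 / 6"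
  proof -
    have "\<not> Suc (Suc 0) dvd Suc (Suc (Suc 0))" by presburger
    then show ?thesis by (simp add: sin_coeff_def eval_nat_numeral field_simps)
  qed
  then have "\<bar>sin y - (y - y ^ 3 / 6)\<bar> \<le> y ^ 4 / 24"
    using Maclaurin_sin_bound[of y 4] assms by (simp add: fact_numeral)
  then show "sin y \<le> y - y ^ 3 / 6 + y ^ 4 / 24" "y - y ^ 3 / 6 - y ^ 4 / 24 \<le> sin y"
    by linarith+
qed

text \<open>With \<open>y = |u| / 2\<close>, Taylor gives \<open>sin y \<ge> 3/4 y\<close>, hence
  \<open>1 - cos u \<ge> 9/32 u^2\<close>, which leaves room for the constant
  \<open>1/4\<close>.\<close>

lemma one_minus_cos_ge:
  fixes u :: real assumes "\<bar>u\<bar> < 1"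
  shows "u\<^sup>2 / 4 \<le> 1 - cos u"
proof -
  define y where "y = \<bar>u\<bar> / 2"
  have y: "0 \<le> y" "y \<le> 1/2" using assms by (auto simp: y_def)
  have "y ^ 3 \<le> y" "y ^ 4 \<le> y"
    using y power_decreasing[of 1 3 y] power_decreasing[of 1 4 y] by auto
  then have "3 / 4 * y \<le> sin y"
    using sin_cubic_bounds(2)[OF y(1)] y by linarith
  then have "(3 / 4 * y)\<^sup>2 \<le> (sin y)\<^sup>2"
    using y by (intro power_mono) auto
  moreover have "1 - cos u = 2 * (sin y)\<^sup>2"
    using one_minus_cos_eq[of "\<bar>u\<bar>"] by (simp add: y_def)
  moreover have "(3 / 4 * y)\<^sup>2 = 9 / 64 * u\<^sup>2"
    by (simp add: y_def power_mult_distrib power_divide)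
  ultimately show ?thesis
    using zero_le_power2[of u] by linarith
qed

text \<open>The right-hand side is the mean of \<open>1 - cos (s y)\<close> over \<open>s\<close> in
  \<open>[0, 1]\<close>. Up to \<open>y = 2\<close> the Taylor bound applies; beyond,
  \<open>sin y \<le> 1 \<le> y / 2\<close>. Negative \<open>y\<close> follow by evenness.\<close>

lemma one_minus_sinc_ge:
  fixes y :: real assumes "y \<noteq> 0"
  shows "min 1 (y\<^sup>2) / 12 \<le> 1 - sin y / y"
proof -
  have pos: "min 1 (y\<^sup>2) / 12 \<le> 1 - sin y / y" if y: "y > 0" for y :: real
  proof (cases "y \<le> 2")
    case True
    have "y * y ^ 3 \<le> 2 * y ^ 3" using True y by (intro mult_right_mono) auto
    moreover have "y ^ 4 = y * y ^ 3" by (simp add: eval_nat_numeral)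
    ultimately have "sin y \<le> y - y ^ 3 / 12"
      using sin_cubic_bounds(1)[of y] y by linarith
    then have "sin y / y \<le> (y - y ^ 3 / 12) / y"
      using y by (intro divide_right_mono) auto
    also have "\<dots> = 1 - y\<^sup>2 / 12"
      using y by (simp add: field_simps eval_nat_numeral)
    finally show ?thesis by linarith
  next
    case False
    then have "sin y \<le> y / 2"
      using sin_le_one[of y] by linarith
    then have "sin y / y \<le> 1 / 2"
      using y by (simp add: field_simps)
    then show ?thesis by linarith
  qed
  show ?thesis
    using pos[of y] pos[of "- y"] assms by (cases "y > 0") auto
qed

lemma inner_sq_le: "(x \<bullet> z)\<^sup>2 \<le> (norm x)\<^sup>2 * (norm z)\<^sup>2" for x z :: "'a::real_inner"
  by (simp add: power2_norm_eq_inner Cauchy_Schwarz_ineq)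

lemma min_scale_le: "0 \<le> u \<Longrightarrow> 0 \<le> c \<Longrightarrow> min 1 (c * u) \<le> max 1 c * min 1 u" for c u :: real
proof (cases "u \<le> 1")
  case True
  assume "0 \<le> u"
  then have "c * u \<le> max 1 c * u" by (intro mult_right_mono) auto
  with True show ?thesis by (simp add: min_def)
qed (auto simp: min.coboundedI1)

lemma min_sum_le:
  fixes f :: "'i \<Rightarrow> real"
  assumes "finite S" "\<And>i. i \<in> S \<Longrightarrow> 0 \<le> f i"
  shows "min 1 (sum f S) \<le> (\<Sum>i\<in>S. min 1 (f i))"
  using assms
proof (induction S rule: finite_induct)
  case (insert i S)
  have "0 \<le> sum f S" using insert by (intro sum_nonneg) auto
  then have "min 1 (f i + sum f S) \<le> min 1 (f i) + min 1 (sum f S)"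
    using insert.prems[of i] by auto
  also have "\<dots> \<le> min 1 (f i) + (\<Sum>i\<in>S. min 1 (f i))"
    using insert by auto
  finally show ?case using insert by simp
qed simp

lemma nn_integral_one_minus_cos:
  fixes r u :: real
  assumes "0 < r" "u \<noteq> 0"
  shows "(\<integral>\<^sup>+s. ennreal (1 - cos (s * u)) * indicator {0..r} s \<partial>lborel) = ennreal (r - sin (r * u) / u)"
proof -
  have "(\<integral>\<^sup>+s. ennreal (1 - cos (s * u)) * indicator {0..r} s \<partial>lborel)
      = ennreal ((r - sin (r * u) / u) - (0 - sin (0 * u) / u))"
    by (rule nn_integral_FTC_Icc) (use assms in \<open>auto intro!: derivative_eq_intros\<close>)
  then show ?thesis by simp
qed

lemma dyadic_bracket:
  fixes y :: real
  assumes "1 \<le> y"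
  obtains n :: nat where "2 ^ n \<le> y" "y < 2 ^ Suc n"
proof -
  obtain m :: nat where "y < 2 ^ m"
    using real_arch_pow[of 2 y] by auto
  then have ex: "\<exists>m. y < 2 ^ m" by blast
  define m where "m = (LEAST m. y < 2 ^ m)"
  have m: "y < 2 ^ m" unfolding m_def by (rule LeastI_ex[OF ex])
  then have "m \<noteq> 0" using assms by (cases m) auto
  then obtain n where n: "m = Suc n" by (cases m) auto
  then have "\<not> y < 2 ^ n"
    using not_less_Least[of n "\<lambda>m. y < 2 ^ m"] by (simp add: m_def[symmetric])
  then show ?thesis using m n that[of n] by simp
qed

section \<open>The exponent of a generating triplet\<close>

locale levy_triplet =
  fixes A :: "real^'n^'n" and b :: "real^'n" and N :: "(real^'n) measure"
  assumes A_sym: "transpose A = A"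
    and A_psd: "\<And>x. 0 \<le> x \<bullet> (A *v x)"
    and N_levy: "is_levy_measure N"
begin

abbreviation "h \<equiv> levy_h A N"
abbreviation "\<Psi>\<^sub>R x \<equiv> Re (levy_exponent A b N x)"
abbreviation "\<Psi>\<^sub>S \<equiv> psi_star A b N"
abbreviation "Q x \<equiv> x \<bullet> (A *v x)"
definition "J x = (\<integral> z. 1 - cos (x \<bullet> z) \<partial>N)"
definition "V x = Q x + (\<integral> z. indicator {z. \<bar>x \<bullet> z\<bar> < 1} z * (x \<bullet> z)\<^sup>2 \<partial>N)"

lemma sets_N [measurable_cong, simp]: "sets N = sets borel"
  using N_levy by (simp add: is_levy_measure_def)

lemma space_N [simp]: "space N = UNIV"
  using sets_eq_imp_space_eq[OF sets_N] by simp

lemma integrable_min: "integrable N (\<lambda>z. min 1 ((norm z)\<^sup>2))"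
  using N_levy by (auto simp: is_levy_measure_def integrable_iff_bounded)

lemma integrable_levyI:
  fixes f :: "real^'n \<Rightarrow> 'b::{banach,second_countable_topology}"
  assumes "f \<in> borel_measurable borel" and "\<And>z. norm (f z) \<le> C * min 1 ((norm z)\<^sup>2)"
  shows "integrable N f"
proof (rule Bochner_Integration.integrable_bound)
  show "integrable N (\<lambda>z. C * min 1 ((norm z)\<^sup>2))"
    using integrable_min by simp
  show "AE z in N. norm (f z) \<le> norm (C * min 1 ((norm z)\<^sup>2))"
    using assms(2) by (intro AE_I2) (auto intro: order_trans[OF _ abs_ge_self])
qed (use assms in measurable)

lemma integrable_min_inner: "integrable N (\<lambda>z. min 1 (c * (x \<bullet> z)\<^sup>2))" if "0 \<le> c"
proof (rule integrable_levyI)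
  fix z
  have "min 1 (c * (x \<bullet> z)\<^sup>2) \<le> min 1 ((c * (norm x)\<^sup>2) * (norm z)\<^sup>2)"
    unfolding mult.assoc by (intro min.mono mult_left_mono inner_sq_le that order_refl)
  also have "\<dots> \<le> max 1 (c * (norm x)\<^sup>2) * min 1 ((norm z)\<^sup>2)"
    using that by (intro min_scale_le) auto
  finally show "norm (min 1 (c * (x \<bullet> z)\<^sup>2)) \<le> max 1 (c * (norm x)\<^sup>2) * min 1 ((norm z)\<^sup>2)"
    using that by simp
qed auto

lemma integrable_min_norm: "integrable N (\<lambda>z. min 1 (c * (norm z)\<^sup>2))" if "0 \<le> c"
proof (rule integrable_levyI)
  fix z
  show "norm (min 1 (c * (norm z)\<^sup>2)) \<le> max 1 c * min 1 ((norm z)\<^sup>2)"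
    using min_scale_le[of "(norm z)\<^sup>2" c] that by simp
qed simp

lemma integrable_one_minus_cos: "integrable N (\<lambda>z. 1 - cos (x \<bullet> z))"
proof (rule Bochner_Integration.integrable_bound)
  show "integrable N (\<lambda>z. 2 * min 1 (1/4 * (x \<bullet> z)\<^sup>2))"
    using integrable_min_inner[of "1/4" x] by simp
  show "AE z in N. norm (1 - cos (x \<bullet> z)) \<le> norm (2 * min 1 (1/4 * (x \<bullet> z)\<^sup>2))"
    using one_minus_cos_le by (intro AE_I2) auto
qed auto

lemma integrable_truncated: "integrable N (\<lambda>z. indicator {z. \<bar>x \<bullet> z\<bar> < 1} z * (x \<bullet> z)\<^sup>2)"
proof (rule Bochner_Integration.integrable_bound[OF integrable_min_inner[of 1 x]])
  show "AE z in N. norm (indicator {z. \<bar>x \<bullet> z\<bar> < 1} z * (x \<bullet> z)\<^sup>2) \<le> norm (min 1 (1 * (x \<bullet> z)\<^sup>2))"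
    by (intro AE_I2) (auto simp: indicator_def abs_square_less_1 power_le_one_iff less_imp_le)
qed auto

text \<open>The drift and the compensator are purely imaginary. Taking the real part under the
  integral needs integrability of the full integrand: second order Taylor inside the unit ball,
  where the compensator acts, and the bound 2 outside.\<close>

lemma Re_levy_exponent: "\<Psi>\<^sub>R x = Q x + J x"
proof -
  let ?f = "\<lambda>z. cis (x \<bullet> z) - 1 - \<i> * complex_of_real ((x \<bullet> z) * indicator (ball 0 1) z)"
  have "integrable N ?f"
  proof (rule integrable_levyI)
    fix z :: "real^'n"
    show "norm (?f z) \<le> max 2 ((norm x)\<^sup>2) * min 1 ((norm z)\<^sup>2)"
    proof (cases "norm z < 1")
      case True
      have "norm (?f z) \<le> (x \<bullet> z)\<^sup>2 / 2"
        using iexp_approx1[of "x \<bullet> z" 1] True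
        by (simp add: cis_conv_exp algebra_simps numeral_2_eq_2)
      also have "\<dots> \<le> (norm x)\<^sup>2 * (norm z)\<^sup>2"
        using inner_sq_le[of x z] zero_le_power2[of "x \<bullet> z"] by linarith
      also have "\<dots> \<le> max 2 ((norm x)\<^sup>2) * (norm z)\<^sup>2"
        by (intro mult_right_mono) auto
      finally show ?thesis using True by (simp add: min_absorb2 power_le_one)
    next
      case False
      then have "norm (?f z) \<le> 2"
        using norm_triangle_ineq4[of "cis (x \<bullet> z)" 1] by simp
      moreover have "min 1 ((norm z)\<^sup>2) = 1"
        using False by (simp add: min_absorb1 one_le_power)
      ultimately show ?thesis by simp
    qed
    have [measurable]: "(\<lambda>z. indicator (ball 0 1) z :: real) \<in> borel_measurable (borel :: (real^'n) measure)"
      by (intro borel_measurable_indicator) simp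
    show "?f \<in> borel_measurable borel" by measurable
  qed
  then have "Re (CLINT z|N. ?f z) = (\<integral>z. Re (?f z) \<partial>N)"
    by (rule integral_Re[symmetric])
  also have "\<dots> = (\<integral>z. - (1 - cos (x \<bullet> z)) \<partial>N)"
    by simp
  also have "\<dots> = - (\<integral>z. 1 - cos (x \<bullet> z) \<partial>N)"
    by (rule integral_minus)
  finally show ?thesis by (simp add: levy_exponent_def J_def)
qed

lemma Re_levy_exponent_nonneg: "0 \<le> \<Psi>\<^sub>R x"
  unfolding Re_levy_exponent J_def using A_psd by (intro add_nonneg_nonneg integral_nonneg) auto

lemma V_nonneg: "0 \<le> V x"
  unfolding V_def
  using A_psd by (intro add_nonneg_nonneg integral_nonneg) auto

lemma A_adj: "x \<bullet> (A *v y) = y \<bullet> (A *v x)"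
  using dot_lmul_matrix[of x A y] transpose_matrix_vector[of A x] A_sym by (simp add: inner_commute)

lemma Q_scaleR: "Q (c *\<^sub>R x) = c\<^sup>2 * Q x"
  by (simp add: matrix_vector_mult_scaleR power2_eq_square)

lemma Q_add: "Q (x + y) = Q x + Q y + 2 * (x \<bullet> (A *v y))"
  using A_adj[of x y] by (simp add: matrix_vector_right_distrib inner_add)

lemma Q_diff: "Q (x - y) = Q x + Q y - 2 * (x \<bullet> (A *v y))"
  using A_adj[of x y] by (simp add: matrix_vector_mult_diff_distrib inner_diff)

text \<open>The parallelogram law for \<open>Q\<close> and \<open>one_minus_cos_add_le\<close> under
  the integral. It transfers bounds from a ball at the origin to a ball around another
  centre.\<close>

lemma Re_levy_exponent_add_le: "\<Psi>\<^sub>R (x + y) \<le> 2 * \<Psi>\<^sub>R x + 2 * \<Psi>\<^sub>R y"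
proof -
  have lin: "(\<integral>z. 2 * f z + 2 * g z \<partial>N) = 2 * (\<integral>z. f z \<partial>N) + 2 * (\<integral>z. g z \<partial>N)"
    if "integrable N f" "integrable N g" for f g :: "real^'n \<Rightarrow> real"
    using that by simp
  have "Q (x + y) \<le> 2 * Q x + 2 * Q y"
    using A_psd[of "x - y"] Q_add[of x y] Q_diff[of x y] by linarith
  moreover have "(\<integral> z. 1 - cos ((x + y) \<bullet> z) \<partial>N) \<le> (\<integral> z. 2 * (1 - cos (x \<bullet> z)) + 2 * (1 - cos (y \<bullet> z)) \<partial>N)"
    by (intro integral_mono integrable_one_minus_cos Bochner_Integration.integrable_add integrable_mult_right)
       (use one_minus_cos_add_le in \<open>simp add: inner_add_left\<close>)
  moreover have "\<dots> = 2 * (\<integral> z. 1 - cos (x \<bullet> z) \<partial>N) + 2 * (\<integral> z. 1 - cos (y \<bullet> z) \<partial>N)"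
    by (intro lin integrable_one_minus_cos)
  ultimately show ?thesis unfolding Re_levy_exponent J_def[symmetric] by argo
qed

lemma V_le_Re_levy_exponent: "V x \<le> 4 * \<Psi>\<^sub>R x"
proof -
  have "(\<integral> z. indicator {z. \<bar>x \<bullet> z\<bar> < 1} z * (x \<bullet> z)\<^sup>2 \<partial>N) \<le> (\<integral> z. 4 * (1 - cos (x \<bullet> z)) \<partial>N)"
    by (intro integral_mono integrable_truncated integrable_mult_right integrable_one_minus_cos)
       (use one_minus_cos_ge[of "x \<bullet> z" for z] in \<open>fastforce simp: indicator_def\<close>)
  also have "\<dots> = 4 * (\<integral> z. 1 - cos (x \<bullet> z) \<partial>N)" by (rule integral_mult_right_zero)
  finally show ?thesis
    unfolding Re_levy_exponent V_def J_def[symmetric] using A_psd[of x] by argo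
qed

section \<open>Comparison of \<open>\<Psi>\<^sub>S r\<close> with \<open>h (1 / r)\<close>\<close>

lemma Q_le_onorm: "Q x \<le> onorm (\<lambda>x. A *v x) * (norm x)\<^sup>2"
proof -
  have "Q x \<le> norm x * norm (A *v x)" by (rule norm_cauchy_schwarz)
  also have "\<dots> \<le> norm x * (onorm (\<lambda>x. A *v x) * norm x)"
    by (intro mult_left_mono onorm) (auto simp: matrix_vector_mul_bounded_linear)
  finally show ?thesis by (simp add: power2_eq_square mult_ac)
qed

lemma onorm_A_nonneg: "0 \<le> onorm (\<lambda>x. A *v x)"
  by (rule onorm_pos_le) (simp add: matrix_vector_mul_bounded_linear)

lemma levy_h_one_over: "h (1 / r) = onorm (\<lambda>x. A *v x) * r\<^sup>2 + (\<integral> z. min 1 (r\<^sup>2 * (norm z)\<^sup>2) \<partial>N)"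
  by (simp add: levy_h_def power_divide mult.commute)

lemma levy_h_nonneg: "0 \<le> h r"
  unfolding levy_h_def using onorm_A_nonneg by (intro add_nonneg_nonneg integral_nonneg) auto

lemma Re_levy_exponent_le_h:
  assumes "norm x \<le> r"
  shows "\<Psi>\<^sub>R x \<le> 2 * h (1 / r)"
proof -
  have "(norm x)\<^sup>2 \<le> r\<^sup>2" using assms by (simp add: power_mono)
  then have "Q x \<le> onorm (\<lambda>x. A *v x) * r\<^sup>2"
    using mult_left_mono[OF _ onorm_A_nonneg] Q_le_onorm[of x] by (meson order_trans)
  moreover have "(\<integral> z. 1 - cos (x \<bullet> z) \<partial>N) \<le> (\<integral> z. 2 * min 1 (r\<^sup>2 * (norm z)\<^sup>2) \<partial>N)"
  proof (intro integral_mono integrable_one_minus_cos integrable_mult_right integrable_min_norm)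
    fix z
    have "(x \<bullet> z)\<^sup>2 / 4 \<le> r\<^sup>2 * (norm z)\<^sup>2"
      using inner_sq_le[of x z] mult_right_mono[OF \<open>(norm x)\<^sup>2 \<le> r\<^sup>2\<close> zero_le_power2[of "norm z"]] zero_le_power2[of "x \<bullet> z"]
      by linarith
    then show "1 - cos (x \<bullet> z) \<le> 2 * min 1 (r\<^sup>2 * (norm z)\<^sup>2)"
      using one_minus_cos_le[of "x \<bullet> z"] by linarith
  qed auto
  moreover have "(\<integral> z. 2 * min 1 (r\<^sup>2 * (norm z)\<^sup>2) \<partial>N) = 2 * (\<integral> z. min 1 (r\<^sup>2 * (norm z)\<^sup>2) \<partial>N)"
    by (rule integral_mult_right_zero)
  moreover have "0 \<le> onorm (\<lambda>x. A *v x) * r\<^sup>2" using onorm_A_nonneg by simp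
  ultimately show ?thesis unfolding levy_h_one_over Re_levy_exponent J_def[symmetric] distrib_left by linarith
qed

lemma bdd_above_Re_levy_exponent: "bdd_above (\<Psi>\<^sub>R ` cball 0 r)"
  by (rule bdd_aboveI2[where M="2 * h (1 / r)"]) (auto intro: Re_levy_exponent_le_h)

lemma Re_levy_exponent_le_psi_star: "norm x \<le> r \<Longrightarrow> \<Psi>\<^sub>R x \<le> \<Psi>\<^sub>S r"
  unfolding psi_star_def by (intro cSUP_upper bdd_above_Re_levy_exponent) auto

lemma psi_star_le_h: "0 \<le> r \<Longrightarrow> \<Psi>\<^sub>S r \<le> 2 * h (1 / r)"
  unfolding psi_star_def by (intro cSUP_least) (auto intro: Re_levy_exponent_le_h)

lemma psi_star_nonneg: "0 \<le> r \<Longrightarrow> 0 \<le> \<Psi>\<^sub>S r"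
  using Re_levy_exponent_le_psi_star[of 0 r] Re_levy_exponent_nonneg[of 0] by simp

lemma Q_le_Re_levy_exponent: "Q x \<le> \<Psi>\<^sub>R x"
  unfolding Re_levy_exponent J_def by (simp add: integral_nonneg)

text \<open>Scaling to the sphere of radius \<open>r\<close> bounds the quadratic form by
  \<open>M |w|^2\<close>. For the symmetric nonnegative \<open>A\<close>, polarisation turns this
  into a bound of the operator norm by the same \<open>M\<close>.\<close>

lemma onorm_le_psi_star:
  assumes "r > 0"
  shows "onorm (\<lambda>x. A *v x) * r\<^sup>2 \<le> \<Psi>\<^sub>S r"
proof -
  define M where "M = \<Psi>\<^sub>S r / r\<^sup>2"
  have M: "Q w \<le> M * (norm w)\<^sup>2" for w
  proof (cases "w = 0")
    case False
    have "Q ((r / norm w) *\<^sub>R w) \<le> \<Psi>\<^sub>S r"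
      using False assms
      by (intro order_trans[OF Q_le_Re_levy_exponent Re_levy_exponent_le_psi_star]) auto
    then have "r\<^sup>2 * Q w / (norm w)\<^sup>2 \<le> \<Psi>\<^sub>S r"
      unfolding Q_scaleR by (simp add: power_divide)
    then show ?thesis
      using False assms unfolding M_def by (simp add: pos_divide_le_eq pos_le_divide_eq mult.commute)
  qed simp
  have unit: "v \<bullet> (A *v u) \<le> M" if "norm u = 1" "norm v = 1" for u v
  proof -
    have "4 * (v \<bullet> (A *v u)) = Q (v + u) - Q (v - u)"
      unfolding Q_add Q_diff by simp
    also have "\<dots> \<le> M * (norm (v + u))\<^sup>2"
      using M[of "v + u"] A_psd[of "v - u"] by linarith
    also have "\<dots> \<le> M * 2\<^sup>2"
      using norm_triangle_ineq[of v u] that psi_star_nonneg[of r] assms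
      by (intro mult_left_mono power_mono) (auto simp: M_def)
    finally show ?thesis by simp
  qed
  have "norm (A *v x) \<le> M * norm x" for x
  proof (cases "x = 0 \<or> A *v x = 0")
    case True
    then show ?thesis
      using psi_star_nonneg[of r] assms by (auto simp: M_def)
  next
    case False
    let ?u = "x /\<^sub>R norm x" and ?v = "(A *v x) /\<^sub>R norm (A *v x)"
    have "?v \<bullet> (A *v ?u) \<le> M"
      using False by (intro unit) auto
    also have "?v \<bullet> (A *v ?u) = norm (A *v x) / norm x"
      using False by (simp add: matrix_vector_mult_scaleR dot_square_norm power2_eq_square divide_inverse)
    finally show ?thesis using False by (simp add: pos_divide_le_eq)
  qed
  then have "onorm (\<lambda>x. A *v x) \<le> M" by (rule onorm_le)
  then show ?thesis using assms by (simp add: M_def pos_le_divide_eq)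
qed

text \<open>\<open>N\<close> may be infinite near 0, but it is finite away from 0 and has no atom
  there. Fubini in the averaging argument rests on this.\<close>

lemma sigma_finite_N: "sigma_finite_measure N"
proof
  let ?S = "\<lambda>n::nat. {z::real^'n. 1 / Suc n \<le> norm z}"
  let ?A = "insert {0} (range ?S)"
  have "emeasure N (?S n) \<noteq> \<infinity>" for n
  proof -
    have "integrable N (indicator (?S n) :: _ \<Rightarrow> real)"
    proof (rule integrable_levyI)
      fix z :: "real^'n"
      show "norm (indicator (?S n) z :: real) \<le> (real (Suc n))\<^sup>2 * min 1 ((norm z)\<^sup>2)"
      proof (cases "z \<in> ?S n")
        case True
        then have "1 \<le> real (Suc n) * norm z" by (simp add: divide_le_eq mult.commute)
        then have "1 \<le> (real (Suc n) * norm z)\<^sup>2" by (rule one_le_power)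
        moreover have "1 \<le> (real (Suc n))\<^sup>2" by (rule one_le_power) simp
        ultimately show ?thesis
          using True by (auto simp: min_def power_mult_distrib)
      qed simp
    qed simp
    then show ?thesis by (simp add: integrable_indicator_iff less_top)
  qed
  moreover have "\<Union>?A = UNIV"
  proof (rule UNIV_eq_I[symmetric])
    fix z :: "real^'n"
    show "z \<in> \<Union>?A"
    proof (cases "z = 0")
      case False
      then obtain n where "inverse (real (Suc n)) < norm z"
        using reals_Archimedean[of "norm z"] by auto
      then have "z \<in> ?S n" by (simp add: inverse_eq_divide)
      then show ?thesis by blast
    qed simp
  qed
  moreover have "?A \<subseteq> sets N" by auto
  moreover have "countable ?A" by simp
  moreover have "emeasure N {0} \<noteq> \<infinity>" using N_levy by (simp add: is_levy_measure_def)
  ultimately show "\<exists>A. countable A \<and> A \<subseteq> sets N \<and> \<Union>A = space N \<and> (\<forall>a\<in>A. emeasure N a \<noteq> \<infinity>)"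
    unfolding space_N by (intro exI[of _ ?A]) blast
qed

text \<open>The function \<open>1 - cos u\<close> vanishes at arbitrarily large \<open>u\<close>; its average over the dilations
  \<open>s u\<close>, \<open>0 \<le> s \<le> r\<close>, does not.\<close>

lemma integral_min_direction_le:
  assumes "r > 0" "norm e \<le> 1"
  shows "(\<integral>z. min 1 (r\<^sup>2 * (e \<bullet> z)\<^sup>2) \<partial>N) \<le> 12 * \<Psi>\<^sub>S r"
proof -
  interpret N: sigma_finite_measure N by (rule sigma_finite_N)
  interpret P: pair_sigma_finite lborel N ..
  let ?m = "\<lambda>z. min 1 (r\<^sup>2 * (e \<bullet> z)\<^sup>2)"
  have "ennreal (r / 12 * (\<integral>z. ?m z \<partial>N)) = ennreal (\<integral>z. r / 12 * ?m z \<partial>N)"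
    by simp
  also have "\<dots> = (\<integral>\<^sup>+z. ennreal (r / 12 * ?m z) \<partial>N)"
    using assms by (intro nn_integral_eq_integral[symmetric] integrable_mult_right integrable_min_inner) auto
  \<comment> \<open>The factor \<open>r / 12\<close> is the interval length times the constant of
    \<open>one_minus_sinc_ge\<close> taken at \<open>y = r * (e \<bullet> z)\<close>.\<close>
  also have "\<dots> \<le> (\<integral>\<^sup>+z. \<integral>\<^sup>+s. ennreal (1 - cos (s * (e \<bullet> z))) * indicator {0..r} s \<partial>lborel \<partial>N)"
  proof (rule nn_integral_mono)
    fix z
    show "ennreal (r / 12 * ?m z) \<le> (\<integral>\<^sup>+s. ennreal (1 - cos (s * (e \<bullet> z))) * indicator {0..r} s \<partial>lborel)"
    proof (cases "e \<bullet> z = 0")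
      case False
      have "min 1 ((r * (e \<bullet> z))\<^sup>2) / 12 \<le> 1 - sin (r * (e \<bullet> z)) / (r * (e \<bullet> z))"
        using False assms by (intro one_minus_sinc_ge) auto
      then have "r * (min 1 ((r * (e \<bullet> z))\<^sup>2) / 12) \<le> r * (1 - sin (r * (e \<bullet> z)) / (r * (e \<bullet> z)))"
        using assms by (intro mult_left_mono) auto
      then have "r / 12 * ?m z \<le> r - sin (r * (e \<bullet> z)) / (e \<bullet> z)"
        using assms False by (simp add: power_mult_distrib right_diff_distrib)
      then show ?thesis
        using False assms by (simp add: nn_integral_one_minus_cos ennreal_leI)
    qed simp
  qed
  also have "\<dots> = (\<integral>\<^sup>+s. \<integral>\<^sup>+z. ennreal (1 - cos (s * (e \<bullet> z))) * indicator {0..r} s \<partial>N \<partial>lborel)"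
    by (rule P.Fubini') measurable
  also have "\<dots> \<le> (\<integral>\<^sup>+s. ennreal (\<Psi>\<^sub>S r) * indicator {0..r} s \<partial>lborel)"
  proof (rule nn_integral_mono)
    fix s :: real
    show "(\<integral>\<^sup>+z. ennreal (1 - cos (s * (e \<bullet> z))) * indicator {0..r} s \<partial>N) \<le> ennreal (\<Psi>\<^sub>S r) * indicator {0..r} s"
    proof (cases "s \<in> {0..r}")
      case True
      have "(\<integral>\<^sup>+z. ennreal (1 - cos (s * (e \<bullet> z))) \<partial>N) = ennreal (J (s *\<^sub>R e))"
        using nn_integral_eq_integral[OF integrable_one_minus_cos[of "s *\<^sub>R e"]]
        by (simp add: J_def)
      also have "\<dots> \<le> ennreal (\<Psi>\<^sub>R (s *\<^sub>R e))"
        unfolding Re_levy_exponent using A_psd[of "s *\<^sub>R e"] by (intro ennreal_leI) linarith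
      also have "\<dots> \<le> ennreal (\<Psi>\<^sub>S r)"
        using True assms mult_mono[of s r "norm e" 1]
        by (intro ennreal_leI Re_levy_exponent_le_psi_star) auto
      finally show ?thesis using True by simp
    qed simp
  qed
  also have "\<dots> = ennreal (\<Psi>\<^sub>S r * r)"
    using assms psi_star_nonneg[of r] by (subst nn_integral_cmult_indicator) (auto simp: ennreal_mult)
  finally have "r / 12 * (\<integral>z. ?m z \<partial>N) \<le> \<Psi>\<^sub>S r * r"
    using assms psi_star_nonneg[of r] by (simp add: ennreal_le_iff)
  then show ?thesis using assms by simp
qed

text \<open>The 1 pays for the Gaussian part (\<open>onorm_le_psi_star\<close>), the 12 for each
  coordinate direction (\<open>integral_min_direction_le\<close>).\<close>

definition "C\<^sub>d = 1 + 12 * real CARD('n)"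

lemma C\<^sub>d_ge_1: "1 \<le> C\<^sub>d"
  by (simp add: C\<^sub>d_def)

text \<open>The converse of \<open>psi_star_le_h\<close>: \<open>|z|^2\<close> is the sum of its
  squared coordinates and \<open>min 1\<close> is subadditive, so the isotropic integral reduces to
  one-dimensional directions.\<close>

lemma h_le_psi_star:
  assumes "r > 0"
  shows "h (1 / r) \<le> C\<^sub>d * \<Psi>\<^sub>S r"
proof -
  have "(\<integral>z. min 1 (r\<^sup>2 * (norm z)\<^sup>2) \<partial>N) \<le> (\<integral>z. (\<Sum>e\<in>Basis. min 1 (r\<^sup>2 * (e \<bullet> z)\<^sup>2)) \<partial>N)"
    by (intro integral_mono Bochner_Integration.integrable_sum integrable_min_norm integrable_min_inner)
       (auto simp: norm_sq_eq_sum_Basis sum_distrib_left intro!: min_sum_le)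
  also have "\<dots> = (\<Sum>e\<in>Basis. \<integral>z. min 1 (r\<^sup>2 * (e \<bullet> z)\<^sup>2) \<partial>N)"
    by (intro Bochner_Integration.integral_sum integrable_min_inner) auto
  also have "\<dots> \<le> (\<Sum>e\<in>(Basis::(real^'n) set). 12 * \<Psi>\<^sub>S r)"
    using assms by (intro sum_mono integral_min_direction_le) auto
  also have "\<dots> = 12 * real CARD('n) * \<Psi>\<^sub>S r" by simp
  finally show ?thesis
    using onorm_le_psi_star[OF assms] unfolding levy_h_one_over C\<^sub>d_def by (simp add: distrib_right)
qed

section \<open>Regularity of \<open>h\<close>\<close>

text \<open>This is \<open>h\<close> in the variable \<open>s = 1 / r^2\<close>, in which it is
  concave as an integral of minima of affine functions. Continuity and, once \<open>h\<close> is
  unbounded, strict monotonicity come from concavity.\<close>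

definition "H s = onorm (\<lambda>x. A *v x) * s + (\<integral> z. min 1 (s * (norm z)\<^sup>2) \<partial>N)"

lemma levy_h_eq_H: "h r = H (1 / r\<^sup>2)"
  by (simp add: levy_h_def H_def)

lemma H_mono: "0 \<le> s \<Longrightarrow> s \<le> t \<Longrightarrow> H s \<le> H t"
  unfolding H_def
  by (intro add_mono mult_left_mono integral_mono integrable_min_norm onorm_A_nonneg min.mono mult_right_mono) auto

lemma concave_H: "concave_on {0<..} H"
  unfolding concave_on_iff
proof (intro conjI ballI allI impI)
  fix s t u v :: real
  assume *: "s \<in> {0<..}" "t \<in> {0<..}" "0 \<le> u" "0 \<le> v" "u + v = 1"
  have "(\<integral>z. u * min 1 (s * (norm z)\<^sup>2) + v * min 1 (t * (norm z)\<^sup>2) \<partial>N) \<le> (\<integral>z. min 1 ((u * s + v * t) * (norm z)\<^sup>2) \<partial>N)"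
  proof (intro integral_mono Bochner_Integration.integrable_add integrable_mult_right integrable_min_norm)
    fix z :: "real^'n"
    have "u * min 1 (s * (norm z)\<^sup>2) + v * min 1 (t * (norm z)\<^sup>2) \<le> u * 1 + v * 1"
      using * by (intro add_mono mult_left_mono) auto
    moreover have "u * min 1 (s * (norm z)\<^sup>2) + v * min 1 (t * (norm z)\<^sup>2) \<le> u * (s * (norm z)\<^sup>2) + v * (t * (norm z)\<^sup>2)"
      using * by (intro add_mono mult_left_mono) auto
    ultimately show "u * min 1 (s * (norm z)\<^sup>2) + v * min 1 (t * (norm z)\<^sup>2) \<le> min 1 ((u * s + v * t) * (norm z)\<^sup>2)"
      using * by (simp add: distrib_right mult.assoc)
  qed (use * in auto)
  moreover have "(\<integral>z. u * min 1 (s * (norm z)\<^sup>2) + v * min 1 (t * (norm z)\<^sup>2) \<partial>N)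
      = u * (\<integral>z. min 1 (s * (norm z)\<^sup>2) \<partial>N) + v * (\<integral>z. min 1 (t * (norm z)\<^sup>2) \<partial>N)"
    using * integrable_min_norm[of s] integrable_min_norm[of t] by simp
  ultimately show "u * H s + v * H t \<le> H (u *\<^sub>R s + v *\<^sub>R t)"
    unfolding H_def by (simp add: algebra_simps)
qed simp

lemma continuous_on_H: "continuous_on {0<..} H"
proof -
  have "continuous_on {0<..} (\<lambda>x. - H x)"
    using concave_H by (intro convex_on_continuous) (auto simp: concave_on_def)
  then have "continuous_on {0<..} (\<lambda>x. - (- H x))" by (rule continuous_on_minus)
  then show ?thesis by simp
qed

lemma H_small:
  assumes "u > 0"
  obtains s where "s > 0" "H s \<le> u"
proof -
  have lim0: "(\<lambda>n. 1 / real (Suc n)) \<longlonglongrightarrow> 0"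
    by (rule LIMSEQ_Suc[OF lim_1_over_n])
  have "(\<lambda>n. \<integral>z. min 1 (1 / real (Suc n) * (norm z)\<^sup>2) \<partial>N) \<longlonglongrightarrow> (\<integral>z. 0 \<partial>N)"
  proof (rule integral_dominated_convergence[where w="\<lambda>z. min 1 ((norm z)\<^sup>2)"])
    show "AE z in N. (\<lambda>n. min 1 (1 / real (Suc n) * (norm z)\<^sup>2)) \<longlonglongrightarrow> 0"
    proof (rule AE_I2)
      fix z :: "real^'n"
      have "(\<lambda>n. min 1 (1 / real (Suc n) * (norm z)\<^sup>2)) \<longlonglongrightarrow> min 1 (0 * (norm z)\<^sup>2)"
        by (intro tendsto_intros lim0)
      then show "(\<lambda>n. min 1 (1 / real (Suc n) * (norm z)\<^sup>2)) \<longlonglongrightarrow> 0" by simp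
    qed
    show "AE z in N. norm (min 1 (1 / real (Suc n) * (norm z)\<^sup>2)) \<le> min 1 ((norm z)\<^sup>2)" for n
    proof (rule AE_I2)
      fix z :: "real^'n"
      have "1 / real (Suc n) * (norm z)\<^sup>2 \<le> 1 * (norm z)\<^sup>2"
        by (intro mult_right_mono) auto
      moreover have "0 \<le> 1 / real (Suc n) * (norm z)\<^sup>2" by simp
      ultimately show "norm (min 1 (1 / real (Suc n) * (norm z)\<^sup>2)) \<le> min 1 ((norm z)\<^sup>2)"
        unfolding real_norm_def by linarith
    qed
  qed (auto simp: integrable_min)
  then have "(\<lambda>n. H (1 / real (Suc n))) \<longlonglongrightarrow> onorm (\<lambda>x. A *v x) * 0 + (\<integral>z. 0 \<partial>N)"
    unfolding H_def by (intro tendsto_intros lim0)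
  then have "(\<lambda>n. H (1 / real (Suc n))) \<longlonglongrightarrow> 0" by simp
  then have "eventually (\<lambda>n. H (1 / real (Suc n)) < u) sequentially"
    using assms by (rule order_tendstoD)
  then obtain n where "H (1 / real (Suc n)) < u"
    by (auto simp: eventually_sequentially)
  then show ?thesis by (intro that[of "1 / real (Suc n)"]) auto
qed

section \<open>Behaviour along rays\<close>

text \<open>Where \<open>|x \<bullet> z| < 1\<close> the cosine is expanded to second order, which
  scales by \<open>m^2\<close>. Elsewhere \<open>|x| |z| \<ge> 1\<close>, so the integrand of
  \<open>h (1 / |x|)\<close> equals 1 and the trivial bound 2 suffices for every
  \<open>m\<close>.\<close>

lemma Re_levy_exponent_multiple_le:
  "\<Psi>\<^sub>R (m *\<^sub>R x) \<le> m\<^sup>2 * V x + 2 * h (1 / norm x)"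
proof -
  let ?i = "\<lambda>z. indicator {z. \<bar>x \<bullet> z\<bar> < 1} z * (x \<bullet> z)\<^sup>2" and ?m = "\<lambda>z. min 1 ((norm x)\<^sup>2 * (norm z)\<^sup>2)"
  have "J (m *\<^sub>R x) \<le> (\<integral>z. m\<^sup>2 * ?i z + 2 * ?m z \<partial>N)"
    unfolding J_def
  proof (intro integral_mono integrable_one_minus_cos Bochner_Integration.integrable_add integrable_mult_right
      integrable_min_norm integrable_truncated)
    fix z :: "real^'n"
    show "1 - cos ((m *\<^sub>R x) \<bullet> z) \<le> m\<^sup>2 * ?i z + 2 * ?m z"
    proof (cases "\<bar>x \<bullet> z\<bar> < 1")
      case True
      have "1 - cos ((m *\<^sub>R x) \<bullet> z) \<le> (m * (x \<bullet> z))\<^sup>2 / 2"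
        using one_minus_cos_le[of "m * (x \<bullet> z)"] by simp
      also have "\<dots> \<le> m\<^sup>2 * (x \<bullet> z)\<^sup>2"
        by (simp add: power_mult_distrib)
      also have "\<dots> = m\<^sup>2 * ?i z" using True by simp
      moreover have "0 \<le> ?m z" by simp
      ultimately show ?thesis by linarith
    next
      case False
      then have "1 \<le> (x \<bullet> z)\<^sup>2" by (simp add: abs_square_less_1 not_less[symmetric])
      then have "?m z = 1"
        using inner_sq_le[of x z] by (simp add: min_def)
      moreover have "1 - cos ((m *\<^sub>R x) \<bullet> z) \<le> 2"
        using cos_ge_minus_one[of "(m *\<^sub>R x) \<bullet> z"] by linarith
      ultimately show ?thesis using False by simp
    qed
  qed auto
  also have "\<dots> = m\<^sup>2 * (\<integral>z. ?i z \<partial>N) + 2 * (\<integral>z. ?m z \<partial>N)"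
    using integrable_truncated[of x] integrable_min_norm[of "(norm x)\<^sup>2"] by simp
  finally show ?thesis
    unfolding Re_levy_exponent V_def levy_h_one_over Q_scaleR
    using mult_nonneg_nonneg[OF onorm_A_nonneg zero_le_power2[of "norm x"]] by (simp add: distrib_left)
qed

text \<open>Replacing the cut-off in \<open>V\<close> by a minimum keeps the large jumps and makes
  the function nondecreasing along rays.\<close>

definition "F x = Q x + (\<integral> z. min 1 ((x \<bullet> z)\<^sup>2) \<partial>N)"

lemma integrable_min_inner_1: "integrable N (\<lambda>z. min 1 ((x \<bullet> z)\<^sup>2))"
  using integrable_min_inner[of 1 x] by simp

lemma F_nonneg: "0 \<le> F x"
  unfolding F_def using A_psd by (intro add_nonneg_nonneg integral_nonneg) auto

lemma V_le_F: "V x \<le> F x"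
  unfolding V_def F_def
  by (intro add_left_mono integral_mono integrable_truncated integrable_min_inner_1)
     (auto simp: indicator_def abs_square_less_1 intro: less_imp_le)

lemma F_le_h: "F x \<le> h (1 / norm x)"
proof -
  have "(\<integral> z. min 1 ((x \<bullet> z)\<^sup>2) \<partial>N) \<le> (\<integral> z. min 1 ((norm x)\<^sup>2 * (norm z)\<^sup>2) \<partial>N)"
    by (intro integral_mono integrable_min_inner_1 integrable_min_norm min.mono inner_sq_le) auto
  then show ?thesis
    unfolding F_def levy_h_one_over using Q_le_onorm[of x] by linarith
qed

lemma F_scale_mono:
  assumes "0 \<le> a" "a \<le> c"
  shows "F (a *\<^sub>R x) \<le> F (c *\<^sub>R x)"
proof -
  have ac: "a\<^sup>2 \<le> c\<^sup>2" using assms by (intro power_mono)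
  then have "(\<integral> z. min 1 (((a *\<^sub>R x) \<bullet> z)\<^sup>2) \<partial>N) \<le> (\<integral> z. min 1 (((c *\<^sub>R x) \<bullet> z)\<^sup>2) \<partial>N)"
    by (intro integral_mono integrable_min_inner_1 min.mono) (auto simp: power_mult_distrib intro!: mult_right_mono)
  then show ?thesis
    unfolding F_def Q_scaleR using ac A_psd[of x] by (intro add_mono mult_right_mono) auto
qed

text \<open>Halving the argument leaves exactly a quarter of \<open>Q (2 x)\<close> and of the
  integrand where \<open>|2 x \<bullet> z| < 1\<close>; the other three quarters form
  \<open>V (2 x)\<close>. On the remaining jumps the minimum only grows.\<close>

lemma F_double: "F x + 3 / 4 * V (2 *\<^sub>R x) \<le> F (2 *\<^sub>R x)"
proof -
  let ?i = "\<lambda>z. indicator {z. \<bar>(2 *\<^sub>R x) \<bullet> z\<bar> < 1} z * ((2 *\<^sub>R x) \<bullet> z)\<^sup>2"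
  have "(\<integral> z. min 1 ((x \<bullet> z)\<^sup>2) + 3 / 4 * ?i z \<partial>N) \<le> (\<integral> z. min 1 (((2 *\<^sub>R x) \<bullet> z)\<^sup>2) \<partial>N)"
  proof (intro integral_mono Bochner_Integration.integrable_add integrable_mult_right integrable_min_inner_1 integrable_truncated)
    fix z
    show "min 1 ((x \<bullet> z)\<^sup>2) + 3 / 4 * ?i z \<le> min 1 (((2 *\<^sub>R x) \<bullet> z)\<^sup>2)"
    proof (cases "\<bar>(2 *\<^sub>R x) \<bullet> z\<bar> < 1")
      case True
      then have "((2 *\<^sub>R x) \<bullet> z)\<^sup>2 < 1" by (rule abs_square_less_1[THEN iffD2])
      then show ?thesis using True by (simp add: power_mult_distrib min_def)
    next
      case False
      then have "1 \<le> ((2 *\<^sub>R x) \<bullet> z)\<^sup>2"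
        using abs_square_less_1[of "(2 *\<^sub>R x) \<bullet> z"] by linarith
      then show ?thesis using False by simp
    qed
  qed
  moreover have "(\<integral> z. min 1 ((x \<bullet> z)\<^sup>2) + 3 / 4 * ?i z \<partial>N) = (\<integral> z. min 1 ((x \<bullet> z)\<^sup>2) \<partial>N) + 3 / 4 * (\<integral>z. ?i z \<partial>N)"
    using integrable_min_inner_1[of x] integrable_truncated[of "2 *\<^sub>R x"]
    by (subst Bochner_Integration.integral_add) (auto simp del: inner_scaleR_left)
  ultimately show ?thesis
    unfolding F_def V_def Q_scaleR distrib_left by simp
qed

section \<open>From (C4) to (C3)\<close>

lemma C4_imp_C3:
  assumes "T > 0" "cond_C4 A b N T"
  shows "cond_C3 A b N T"
proof -
  obtain c where c: "1 \<le> c" and C4: "\<And>x. 1 / T < ereal (norm x) \<Longrightarrow> \<Psi>\<^sub>S (norm x) \<le> c * V x"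
    using assms(2) unfolding cond_C4_def V_def by blast
  have T0: "0 \<le> 1 / T" using assms(1) by (cases T) (auto simp: one_ereal_def zero_ereal_def)
  \<comment> \<open>From the chain \<open>F x \<le> h (1 / |x|) \<le> C\<^sub>d * \<Psi>\<^sub>S |x|
    \<le> C\<^sub>d * c * V x\<close>.\<close>
  define \<kappa> where "\<kappa> = 1 / (C\<^sub>d * c)"
  have Cc: "1 \<le> C\<^sub>d * c" using C\<^sub>d_ge_1 c mult_mono[of 1 C\<^sub>d 1 c] by simp
  have \<kappa>: "0 < \<kappa>" "\<kappa> \<le> 1" using Cc by (auto simp: \<kappa>_def)
  have V_ge: "\<kappa> * F x \<le> V x" if "1 / T < ereal (norm x)" for x
  proof -
    have x: "norm x > 0" using that T0 by (metis ereal_less(2) order_le_less_trans)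
    have "F x \<le> C\<^sub>d * \<Psi>\<^sub>S (norm x)"
      using F_le_h[of x] h_le_psi_star[OF x] by linarith
    also have "\<dots> \<le> C\<^sub>d * (c * V x)"
      using C\<^sub>d_ge_1 C4[OF that] by (intro mult_left_mono) auto
    finally show ?thesis using Cc by (simp add: \<kappa>_def divide_le_eq mult_ac)
  qed
  \<comment> \<open>Inserting \<open>V (2 x) \<ge> \<kappa> * F (2 x)\<close> into
    \<open>F_double\<close> gives \<open>F x \<le> (1 - 3/4 \<kappa>) * F (2 x)\<close>. Since
    \<open>\<kappa> \<le> 1\<close>, \<open>\<beta>\<close> is at most 4, which later yields
    \<open>\<alpha> \<le> 2\<close>.\<close>
  define \<beta> where "\<beta> = 1 / (1 - 3 / 4 * \<kappa>)"
  have \<beta>: "1 < \<beta>" "\<beta> \<le> 4" using \<kappa> by (auto simp: \<beta>_def field_simps)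
  have F2: "\<beta> * F x \<le> F (2 *\<^sub>R x)" if "1 / T < ereal (norm x)" for x
  proof -
    have "ereal (norm x) \<le> ereal (norm (2 *\<^sub>R x))" by simp
    then have "\<kappa> * F (2 *\<^sub>R x) \<le> V (2 *\<^sub>R x)" using that by (intro V_ge) (rule less_le_trans)
    then have "F x \<le> (1 - 3 / 4 * \<kappa>) * F (2 *\<^sub>R x)"
      using F_double[of x] unfolding left_diff_distrib by simp
    then show ?thesis using \<kappa> by (simp add: \<beta>_def field_simps)
  qed
  have Fn: "\<beta> ^ n * F x \<le> F (2 ^ n *\<^sub>R x)" if "1 / T < ereal (norm x)" for x n
  proof (induction n)
    case (Suc n)
    have "norm x \<le> norm ((2 ^ n :: real) *\<^sub>R x)"
      using mult_right_mono[of 1 "2 ^ n" "norm x"] by simp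
    then have "1 / T < ereal (norm ((2 ^ n :: real) *\<^sub>R x))"
      using that by (auto intro: less_le_trans)
    then have "\<beta> * F (2 ^ n *\<^sub>R x) \<le> F (2 ^ Suc n *\<^sub>R x)" using F2[of "2 ^ n *\<^sub>R x"] by simp
    moreover have "\<beta> * (\<beta> ^ n * F x) \<le> \<beta> * F (2 ^ n *\<^sub>R x)"
      using \<beta> Suc by (intro mult_left_mono) auto
    ultimately show ?case by simp
  qed simp
  define \<alpha> where "\<alpha> = log 2 \<beta>"
  have \<alpha>: "0 < \<alpha>" "\<alpha> \<le> 2"
  proof -
    show "0 < \<alpha>" using \<beta> by (simp add: \<alpha>_def)
    have "log 2 \<beta> \<le> log 2 4" using \<beta> by (subst log_le_cancel_iff) auto
    also have "log 2 4 = (2::real)" using log_pow_cancel[of 2 2] by simp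
    finally show "\<alpha> \<le> 2" unfolding \<alpha>_def .
  qed
  have \<beta>_eq: "2 powr \<alpha> = \<beta>" using \<beta> by (simp add: \<alpha>_def)
  \<comment> \<open>The 4 pays for the incomplete last doubling: \<open>l\<close> may be close to
    \<open>2 ^ Suc n\<close>, while the iteration reaches only \<open>2 ^ n\<close>, and one factor
    \<open>\<beta>\<close> is at most 4.\<close>
  have growth: "l powr \<alpha> * F x \<le> 4 * F (l *\<^sub>R x)" if x: "1 / T < ereal (norm x)" and l: "1 \<le> l" for x l
  proof -
    obtain n where n: "2 ^ n \<le> l" "l < 2 ^ Suc n" using dyadic_bracket[OF l] .
    have "l powr \<alpha> \<le> (2 ^ Suc n) powr \<alpha>"
      using n l \<alpha> by (intro powr_mono2) auto
    also have "\<dots> = (2 powr \<alpha>) ^ Suc n"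
      by (simp only: powr_realpow[symmetric] zero_less_numeral powr_powr powr_gt_zero mult.commute)
    also have "\<dots> \<le> 4 * \<beta> ^ n"
      using \<beta> by (simp add: \<beta>_eq)
    finally have "l powr \<alpha> * F x \<le> 4 * \<beta> ^ n * F x"
      using F_nonneg by (intro mult_right_mono) auto
    also have "\<dots> \<le> 4 * F (2 ^ n *\<^sub>R x)" using Fn[OF x, of n] by simp
    also have "\<dots> \<le> 4 * F (l *\<^sub>R x)" using F_scale_mono[of "2 ^ n" l x] n by simp
    finally show ?thesis .
  qed
  \<comment> \<open>The growth estimate loses \<open>4 * C\<^sub>d * c\<close> and the pointwise one
    only \<open>4 * c\<close>, so the first constant serves both.\<close>
  define c3 where "c3 = 1 / (4 * (C\<^sub>d * c))"
  have c3: "0 < c3" "c3 \<le> 1" "c3 \<le> 1 / (4 * c)"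
    using Cc c C\<^sub>d_ge_1 by (auto simp: c3_def field_simps)
  show ?thesis
    unfolding cond_C3_def
  proof (rule exI[of _ c3], rule exI[of _ \<alpha>], intro conjI allI impI)
    fix x :: "real^'n" assume x: "1 / T < ereal (norm x)"
    have "\<Psi>\<^sub>S (norm x) \<le> c * (4 * \<Psi>\<^sub>R x)"
      using C4[OF x] mult_left_mono[OF V_le_Re_levy_exponent, of c x] c by linarith
    then have "1 / (4 * c) * \<Psi>\<^sub>S (norm x) \<le> \<Psi>\<^sub>R x"
      using c by (simp add: divide_le_eq mult_ac)
    moreover have "c3 * \<Psi>\<^sub>S (norm x) \<le> 1 / (4 * c) * \<Psi>\<^sub>S (norm x)"
      using c3 psi_star_nonneg[of "norm x"] by (intro mult_right_mono) auto
    ultimately show "c3 * \<Psi>\<^sub>S (norm x) \<le> \<Psi>\<^sub>R x" by linarith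
  next
    fix l r :: real assume lr: "1 \<le> l \<and> 1 / T < ereal r"
    have r: "r > 0" using lr T0 by (metis ereal_less(2) order_le_less_trans)
    \<comment> \<open>Any direction will do, since \<open>\<Psi>\<^sub>S\<close> depends on the
      radius alone and (C4) holds for all vectors of that length.\<close>
    obtain x :: "real^'n" where x: "norm x = r" using vector_choose_size[of r] r by auto
    have "l powr \<alpha> * \<Psi>\<^sub>S r \<le> l powr \<alpha> * (c * V x)"
      using C4[of x] x lr by (intro mult_left_mono) auto
    also have "\<dots> \<le> c * (l powr \<alpha> * F x)"
      using mult_left_mono[OF V_le_F[of x], of "c * l powr \<alpha>"] c by (simp add: mult_ac)
    also have "\<dots> \<le> c * (4 * F (l *\<^sub>R x))"
      using growth[of x l] x lr c by (intro mult_left_mono) auto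
    also have "\<dots> \<le> c * (4 * (C\<^sub>d * \<Psi>\<^sub>S (l * r)))"
    proof -
      have "F (l *\<^sub>R x) \<le> h (1 / (l * r))" using F_le_h[of "l *\<^sub>R x"] x lr by simp
      also have "\<dots> \<le> C\<^sub>d * \<Psi>\<^sub>S (l * r)" using lr r by (intro h_le_psi_star) auto
      finally show ?thesis using c by (intro mult_left_mono) auto
    qed
    finally have "l powr \<alpha> * \<Psi>\<^sub>S r \<le> 4 * (C\<^sub>d * c) * \<Psi>\<^sub>S (l * r)" by (simp add: mult_ac)
    then show "c3 * l powr \<alpha> * \<Psi>\<^sub>S r \<le> \<Psi>\<^sub>S (l * r)"
      using Cc by (simp add: c3_def divide_le_eq mult_ac)
  qed (use c3 \<alpha> in auto)
qed

end

section \<open>The inverse of the concentration function and the four conditions\<close>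

text \<open>From \<open>(1 + u / k) ^ k \<le> exp u\<close> with
  \<open>u = a * y powr \<alpha>\<close> and \<open>k\<close> so large that
  \<open>\<alpha> * k \<ge> n\<close>.\<close>

lemma exp_minus_le_powr:
  fixes a \<alpha> :: real
  assumes "a > 0" "\<alpha> > 0"
  obtains M where "1 \<le> M" "\<And>y. 1 \<le> y \<Longrightarrow> exp (- a * y powr \<alpha>) \<le> M / y ^ n"
proof -
  obtain k :: nat where k: "real n / \<alpha> < real k" using reals_Archimedean2 by blast
  have k0: "k > 0"
  proof (rule ccontr)
    assume "\<not> k > 0"
    moreover have "0 \<le> real n / \<alpha>" using assms by simp
    ultimately show False using k by simp
  qed
  define M where "M = max 1 ((real k / a) ^ k)"
  show ?thesis
  proof (rule that[of M])
    fix y :: real assume y: "1 \<le> y"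
    have "real n \<le> \<alpha> * real k"
      using k assms by (simp add: divide_less_eq mult.commute less_imp_le)
    then have "y ^ n \<le> y powr (\<alpha> * real k)"
      using y by (simp add: powr_realpow[symmetric] powr_mono)
    also have "\<dots> = (y powr \<alpha>) ^ k"
      using y by (simp add: powr_powr[symmetric] powr_realpow)
    finally have 1: "y ^ n \<le> (y powr \<alpha>) ^ k" .
    have "(a * y powr \<alpha> / real k) ^ k \<le> (1 + a * y powr \<alpha> / real k) ^ k"
      using assms by (intro power_mono) auto
    also have "\<dots> \<le> exp (a * y powr \<alpha>)"
      using k0 assms by (intro exp_ge_one_plus_x_over_n_power_n) (auto intro: order_trans[of _ 0])
    finally have "(a / real k) ^ k * (y powr \<alpha>) ^ k \<le> exp (a * y powr \<alpha>)"
      by (simp add: power_mult_distrib power_divide)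
    moreover have "(a / real k) ^ k * y ^ n \<le> (a / real k) ^ k * (y powr \<alpha>) ^ k"
      using assms 1 by (intro mult_left_mono) auto
    ultimately have "(a / real k) ^ k * y ^ n \<le> exp (a * y powr \<alpha>)"
      by linarith
    then have "(real k / a) ^ k * ((a / real k) ^ k * y ^ n) \<le> (real k / a) ^ k * exp (a * y powr \<alpha>)"
      using assms by (intro mult_left_mono) auto
    also have "(real k / a) ^ k * ((a / real k) ^ k * y ^ n) = y ^ n"
      using assms k0 by (simp add: power_divide)
    also have "(real k / a) ^ k * exp (a * y powr \<alpha>) \<le> M * exp (a * y powr \<alpha>)"
      by (intro mult_right_mono) (auto simp: M_def)
    finally show "exp (- a * y powr \<alpha>) \<le> M / y ^ n"
      using y by (simp add: exp_minus field_simps)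
  qed (simp add: M_def)
qed

text \<open>The function is dominated by a series of multiples of indicators of balls with radii
  \<open>2 ^ Suc n * r\<close>. \<open>B\<close> is chosen before \<open>f\<close> and
  \<open>r\<close>, so one constant will serve all times \<open>t\<close>.\<close>

lemma nn_integral_exp_powr_le:
  assumes "a > 0" "\<alpha> > 0"
  obtains B where "B > 0"
    "\<And>(f :: 'a::euclidean_space \<Rightarrow> real) r. r > 0 \<Longrightarrow> (\<And>z. f z \<le> 1) \<Longrightarrow>
       (\<And>z. r \<le> norm z \<Longrightarrow> f z \<le> exp (- a * (norm z / r) powr \<alpha>)) \<Longrightarrow>
       (\<integral>\<^sup>+z. ennreal (f z) \<partial>lborel) \<le> ennreal (B * r ^ DIM('a))"
proof -
  let ?d = "DIM('a)"
  \<comment> \<open>One power more than the dimension: the volume growth \<open>2 ^ (n * d)\<close>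
    is beaten by a factor \<open>2 ^ n\<close>, leaving a geometric series. \<open>1 \<le> M\<close>
    lets the term \<open>n = 0\<close> cover the ball where only \<open>f \<le> 1\<close> is
    known.\<close>
  obtain M where M: "1 \<le> M" "\<And>y. 1 \<le> y \<Longrightarrow> exp (- a * y powr \<alpha>) \<le> M / y ^ Suc ?d"
    using exp_minus_le_powr[OF assms, of "Suc ?d"] by blast
  define \<omega> where "\<omega> = unit_ball_vol (real ?d)"
  have \<omega>: "\<omega> > 0" by (simp add: \<omega>_def)
  define B where "B = M * \<omega> * 2 ^ ?d * 2"
  show ?thesis
  proof (rule that[of B])
    show "B > 0" using M \<omega> by (simp add: B_def)
    fix f :: "'a \<Rightarrow> real" and r :: real
    assume r: "r > 0" and f1: "\<And>z. f z \<le> 1" and f2: "\<And>z. r \<le> norm z \<Longrightarrow> f z \<le> exp (- a * (norm z / r) powr \<alpha>)"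
    let ?t = "\<lambda>n (z::'a). ennreal (M / 2 ^ (n * Suc ?d)) * indicator (ball 0 (2 ^ Suc n * r)) z"
    have le_suminf: "g n \<le> suminf g" for g :: "nat \<Rightarrow> ennreal" and n
      using sum_le_suminf[OF summableI, of "{n}" g] by simp
    have f_le: "ennreal (f z) \<le> (\<Sum>n. ?t n z)" for z
    proof -
      have "\<exists>n. ennreal (f z) \<le> ?t n z"
      proof (cases "norm z < r")
        case True
        then have "ennreal (f z) \<le> ?t 0 z"
          using f1[of z] M(1) r by (auto intro!: ennreal_leI)
        then show ?thesis by blast
      next
        case False
        then obtain n where n: "2 ^ n \<le> norm z / r" "norm z / r < 2 ^ Suc n"
          using dyadic_bracket[of "norm z / r"] r by auto
        have "f z \<le> exp (- a * (norm z / r) powr \<alpha>)" using f2 False by auto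
        also have "\<dots> \<le> M / (norm z / r) ^ Suc ?d"
          using False r by (intro M) auto
        also have "\<dots> \<le> M / (2 ^ n) ^ Suc ?d"
          using M(1) n r by (intro divide_left_mono power_mono mult_pos_pos zero_less_power) (auto intro: less_le_trans[OF _ n(1)])
        finally have "f z \<le> M / 2 ^ (n * Suc ?d)" by (simp only: power_mult)
        then have "ennreal (f z) \<le> ?t n z"
          using n(2) r by (auto simp: divide_less_eq intro!: ennreal_leI)
        then show ?thesis by blast
      qed
      then obtain n where "ennreal (f z) \<le> ?t n z" by blast
      also have "\<dots> \<le> (\<Sum>n. ?t n z)"
        by (rule le_suminf)
      finally show ?thesis .
    qed
    have "(\<integral>\<^sup>+z. ennreal (f z) \<partial>lborel) \<le> (\<integral>\<^sup>+z. (\<Sum>n. ?t n z) \<partial>lborel)"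
      by (intro nn_integral_mono f_le)
    also have "\<dots> = (\<Sum>n. \<integral>\<^sup>+z. ?t n z \<partial>lborel)"
      by (rule nn_integral_suminf) (auto intro!: borel_measurable_times_ennreal borel_measurable_indicator)
    also have "\<dots> = (\<Sum>n. ennreal (M * \<omega> * 2 ^ ?d * r ^ ?d * (1 / 2) ^ n))"
    proof (rule suminf_cong)
      fix n :: nat
      have "(\<integral>\<^sup>+z. ?t n z \<partial>lborel) = ennreal (M / 2 ^ (n * Suc ?d)) * ennreal (\<omega> * (2 ^ Suc n * r) ^ ?d)"
        using r by (subst nn_integral_cmult_indicator) (auto simp: emeasure_ball \<omega>_def)
      also have "\<dots> = ennreal (M / 2 ^ (n * Suc ?d) * (\<omega> * (2 ^ Suc n * r) ^ ?d))"
        using M r \<omega> by (intro ennreal_mult[symmetric]) auto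
      also have "M / 2 ^ (n * Suc ?d) * (\<omega> * (2 ^ Suc n * r) ^ ?d) = M * \<omega> * 2 ^ ?d * r ^ ?d * (1 / 2) ^ n"
        by (simp add: power_mult_distrib power_add power_mult[symmetric] power_one_over mult.commute field_simps)
      finally show "(\<integral>\<^sup>+z. ?t n z \<partial>lborel) = ennreal (M * \<omega> * 2 ^ ?d * r ^ ?d * (1 / 2) ^ n)" .
    qed
    also have "\<dots> = ennreal (M * \<omega> * 2 ^ ?d * r ^ ?d * 2)"
      using M r \<omega> geometric_sums[of "1/2::real"] by (intro suminf_ennreal_eq sums_mult) auto
    also have "M * \<omega> * 2 ^ ?d * r ^ ?d * 2 = B * r ^ ?d" by (simp add: B_def)
    finally show "(\<integral>\<^sup>+z. ennreal (f z) \<partial>lborel) \<le> ennreal (B * r ^ ?d)" .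
  qed
qed

locale levy_unbounded = levy_triplet A b N
  for A :: "real^'n^'n" and b :: "real^'n" and N :: "(real^'n) measure" +
  assumes h_inf: "filterlim (levy_h A N) at_top (at_right 0)"
begin

abbreviation "h_inv \<equiv> levy_h_inv A N"

section \<open>Inversion of \<open>h\<close>\<close>

lemma H_large:
  obtains s where "s > 0" "u \<le> H s"
proof -
  have "eventually (\<lambda>r. u \<le> h r) (at_right 0)"
    using h_inf by (auto simp: filterlim_at_top)
  then obtain e where e: "e > 0" "\<And>r. 0 < r \<Longrightarrow> r < e \<Longrightarrow> u \<le> h r"
    by (auto simp: eventually_at_right_field)
  have "u \<le> h (e / 2)" using e by simp
  then show ?thesis
    using e by (intro that[of "1 / (e / 2)\<^sup>2"]) (auto simp: levy_h_eq_H)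
qed

text \<open>A concave, nondecreasing and unbounded function is strictly increasing.\<close>

lemma H_strict_mono:
  assumes "0 < s" "s < t"
  shows "H s < H t"
proof -
  obtain w where w: "w > 0" "H t + 1 \<le> H w" by (rule H_large)
  have "t < w"
    using H_mono[of w t] w by (cases "t < w") auto
  \<comment> \<open>The weight that writes \<open>t\<close> as a convex combination of
    \<open>s\<close> and \<open>w\<close>; as \<open>H w > H t\<close>, concavity excludes
    \<open>H s = H t\<close>.\<close>
  define \<theta> where "\<theta> = (t - s) / (w - s)"
  have \<theta>: "0 < \<theta>" "\<theta> \<le> 1"
    using assms \<open>t < w\<close> by (auto simp: \<theta>_def)
  have "\<theta> * (w - s) = t - s" using assms \<open>t < w\<close> by (simp add: \<theta>_def)
  then have t: "(1 - \<theta>) *\<^sub>R s + \<theta> *\<^sub>R w = t" by (simp add: algebra_simps)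
  have "(1 - \<theta>) * H s + \<theta> * H w \<le> H t"
    using concave_onD[OF concave_H, of \<theta> s w] \<theta> assms w t by auto
  moreover have "\<theta> * H s < \<theta> * H w"
    using \<theta> H_mono[of s t] assms w by (intro mult_strict_left_mono) auto
  ultimately show ?thesis by (simp add: algebra_simps)
qed

lemma levy_h_strict_antimono: "0 < r \<Longrightarrow> r < s \<Longrightarrow> h s < h r"
  unfolding levy_h_eq_H
  by (intro H_strict_mono divide_strict_left_mono power_strict_mono) auto

lemma levy_h_surj:
  assumes "u > 0"
  obtains r where "r > 0" "h r = u"
proof -
  obtain s where s: "s > 0" "H s \<le> u" using H_small[OF assms] .
  obtain t where t: "t > 0" "u \<le> H t" using H_large .
  have "H t \<le> H (max s t)" using t by (intro H_mono) auto
  moreover have "continuous_on {s..max s t} H"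
    using s by (intro continuous_on_subset[OF continuous_on_H]) auto
  ultimately obtain w where w: "s \<le> w" "H w = u"
    using IVT'[of H s u "max s t"] s t by auto
  have "w > 0" using s w by auto
  then show ?thesis
    using w by (intro that[of "1 / sqrt w"]) (auto simp: levy_h_eq_H power_divide)
qed

lemma levy_h_inv_levy_h: "r > 0 \<Longrightarrow> h_inv (h r) = r"
  unfolding levy_h_inv_def
  by (rule the_equality) (simp, metis levy_h_strict_antimono linorder_neqE_linordered_idom less_irrefl)

lemma levy_h_inv_pos: "u > 0 \<Longrightarrow> 0 < h_inv u"
  and levy_h_levy_h_inv: "u > 0 \<Longrightarrow> h (h_inv u) = u"
  using levy_h_surj[of u] levy_h_inv_levy_h by metis+

lemma levy_h_pos: "r > 0 \<Longrightarrow> 0 < h r"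
  using levy_h_strict_antimono[of r "r + 1"] levy_h_nonneg[of "r + 1"] by auto

lemma levy_h_less_iff: "r > 0 \<Longrightarrow> s > 0 \<Longrightarrow> h r < h s \<longleftrightarrow> s < r"
  using levy_h_strict_antimono[of r s] levy_h_strict_antimono[of s r] by (cases r s rule: linorder_cases) auto

section \<open>From integral bounds to (C4), and from (C3) to (C2)\<close>

text \<open>The parameter \<open>\<kappa>\<close> serves both hypotheses: it is 1 for (C2) and 2 for
  (C1), where squaring the characteristic function doubles the exponent.\<close>

lemma C4_of_exp_integral_bound:
  assumes "T > 0" "c > 0" "\<kappa> > 0"
    and bound: "\<And>t. 0 < t \<Longrightarrow> ereal t < T \<Longrightarrow>
      (\<integral>\<^sup>+ z. ennreal (exp (- \<kappa> * t * \<Psi>\<^sub>R z)) \<partial>lborel) \<le> ennreal (c * h_inv (1 / t) powr (- real CARD('n)))"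
  shows "\<exists>T'>0. cond_C4 A b N T' \<and> (T = \<infinity> \<longrightarrow> T' = \<infinity>)"
proof -
  define \<omega> where "\<omega> = unit_ball_vol (real CARD('n))"
  have \<omega>: "\<omega> > 0" by (simp add: \<omega>_def)
  \<comment> \<open>In units of \<open>|x|^d\<close>, each ball on which
    \<open>t * \<Psi>\<^sub>R\<close> is at most 10 contributes at least
    \<open>exp (- \<kappa> * 10) * \<omega>\<close>; \<open>K\<close> balls together exceed
    \<open>c\<close>.\<close>
  obtain K :: nat where K: "c < real K * (exp (- \<kappa> * 10) * \<omega>)"
    using reals_Archimedean3[of "exp (- \<kappa> * 10) * \<omega>"] \<omega> by auto
  have K0: "K > 0" using K assms by (cases K) auto
  have key: "\<Psi>\<^sub>S (norm x) \<le> 8 * (real K)\<^sup>2 * V x" if x: "x \<noteq> 0" and xT: "ereal (1 / h (1 / norm x)) < T" for x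
  proof (rule ccontr)
    let ?r = "norm x"
    let ?h = "h (1 / ?r)"
    assume "\<not> ?thesis"
    moreover have "\<Psi>\<^sub>S ?r \<le> 2 * ?h" by (rule psi_star_le_h) simp
    \<comment> \<open>The negated claim reads \<open>8 K^2 V x < \<Psi>\<^sub>S |x|\<close>, and the
      right-hand side is at most twice \<open>?h\<close>.\<close>
    ultimately have V: "4 * (real K)\<^sup>2 * V x \<le> ?h" by simp
    have h0: "?h > 0" using x by (intro levy_h_pos) auto
    let ?B = "\<lambda>k::nat. ball ((2 * real k) *\<^sub>R x) ?r"
    \<comment> \<open>\<open>10 = 2 * 3 + 2 * 2\<close>: the centre \<open>2 k x\<close> costs at
      most \<open>3 * ?h\<close>, the offset inside the ball \<open>2 * ?h\<close>, and
      \<open>Re_levy_exponent_add_le\<close> doubles both.\<close>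
    have le: "\<Psi>\<^sub>R z \<le> 10 * ?h" if "k < K" "z \<in> ?B k" for k z
    proof -
      have "(2 * real k)\<^sup>2 * V x \<le> (2 * real K)\<^sup>2 * V x"
        using that V_nonneg[of x] by (intro mult_right_mono power_mono) auto
      then have "\<Psi>\<^sub>R ((2 * real k) *\<^sub>R x) \<le> 3 * ?h"
        using Re_levy_exponent_multiple_le[of "2 * real k" x] V by (simp add: power_mult_distrib)
      moreover have "\<Psi>\<^sub>R (z - (2 * real k) *\<^sub>R x) \<le> 2 * ?h"
        using that by (intro Re_levy_exponent_le_h) (auto simp: dist_norm norm_minus_commute)
      ultimately show ?thesis
        using Re_levy_exponent_add_le[of "(2 * real k) *\<^sub>R x" "z - (2 * real k) *\<^sub>R x"] by simp
    qed
    have disj: "disjoint_family_on ?B {..<K}"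
      unfolding disjoint_family_on_def
    proof (intro ballI impI disjoint_ballI)
      fix i j :: nat assume "i \<noteq> j"
      have "dist ((2 * real i) *\<^sub>R x) ((2 * real j) *\<^sub>R x) = \<bar>2 * (real i - real j)\<bar> * ?r"
        by (simp add: dist_norm scaleR_diff_left[symmetric] right_diff_distrib)
      moreover have "2 * ?r \<le> \<bar>2 * (real i - real j)\<bar> * ?r"
        using \<open>i \<noteq> j\<close> by (intro mult_right_mono) auto
      ultimately show "?r + ?r \<le> dist ((2 * real i) *\<^sub>R x) ((2 * real j) *\<^sub>R x)" by simp
    qed
    define t where "t = 1 / ?h"
    have t: "t > 0" "1 / t = ?h" using h0 by (auto simp: t_def)
    have "ennreal (real K * (exp (- \<kappa> * 10) * \<omega>) * ?r ^ CARD('n))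
        = ennreal (exp (- \<kappa> * 10)) * (\<Sum>k<K. emeasure lborel (?B k))"
      using \<omega> by (simp add: emeasure_ball \<omega>_def[symmetric] ennreal_mult[symmetric] ennreal_of_nat_eq_real_of_nat mult_ac)
    also have "(\<Sum>k<K. emeasure lborel (?B k)) = emeasure lborel (\<Union>k<K. ?B k)"
      by (rule sum_emeasure) (use disj in auto)
    also have "ennreal (exp (- \<kappa> * 10)) * \<dots> = (\<integral>\<^sup>+z. ennreal (exp (- \<kappa> * 10)) * indicator (\<Union>k<K. ?B k) z \<partial>lborel)"
      by (subst nn_integral_cmult_indicator) auto
    also have "\<dots> \<le> (\<integral>\<^sup>+ z. ennreal (exp (- \<kappa> * t * \<Psi>\<^sub>R z)) \<partial>lborel)"
    proof (intro nn_integral_mono)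
      fix z
      show "ennreal (exp (- \<kappa> * 10)) * indicator (\<Union>k<K. ?B k) z \<le> ennreal (exp (- \<kappa> * t * \<Psi>\<^sub>R z))"
      proof (cases "z \<in> (\<Union>k<K. ?B k)")
        case True
        then have "t * \<Psi>\<^sub>R z \<le> t * (10 * ?h)"
          using le t by (intro mult_left_mono) auto
        also have "\<dots> = 10" using h0 by (simp add: t_def)
        finally have "\<kappa> * (t * \<Psi>\<^sub>R z) \<le> \<kappa> * 10"
          using assms by (intro mult_left_mono) auto
        then show ?thesis using True by (simp add: ennreal_leI mult.assoc)
      qed simp
    qed
    also have "\<dots> \<le> ennreal (c * h_inv (1 / t) powr (- real CARD('n)))"
      using t xT by (intro bound) (auto simp: t_def)
    also have "h_inv (1 / t) powr (- real CARD('n)) = ?r ^ CARD('n)"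
      using x t by (simp add: levy_h_inv_levy_h powr_minus powr_realpow power_one_over inverse_eq_divide)
    finally have "real K * (exp (- \<kappa> * 10) * \<omega>) * ?r ^ CARD('n) \<le> c * ?r ^ CARD('n)"
      using assms by (subst (asm) ennreal_le_iff) auto
    then show False using K x by simp
  qed
  have c: "1 \<le> 8 * (real K)\<^sup>2"
  proof -
    have "1 \<le> (real K)\<^sup>2" using K0 by (intro one_le_power) simp
    then show ?thesis by linarith
  qed
  show ?thesis
  proof (cases T)
    case PInf
    then have "cond_C4 A b N \<infinity>"
      unfolding cond_C4_def using c key by (intro exI[of _ "8 * (real K)\<^sup>2"]) (auto simp: V_def)
    then show ?thesis by (intro exI[of _ \<infinity>]) auto
  next
    case (real T0)
    then have T0: "T0 > 0" using assms by simp
    \<comment> \<open>Since \<open>h\<close> is strictly decreasing, \<open>|x| > 1 / R\<close>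
      places the time \<open>1 / h (1 / |x|)\<close> below \<open>T0\<close>.\<close>
    define R where "R = h_inv (1 / T0)"
    have R: "R > 0" "h R = 1 / T0"
      using T0 by (auto simp: R_def levy_h_inv_pos levy_h_levy_h_inv)
    have "ereal (1 / h (1 / norm x)) < T" "x \<noteq> 0" if "ereal (norm x) > 1 / ereal R" for x :: "real^'n"
    proof -
      have nx: "norm x > 1 / R" using that R by (simp add: one_ereal_def)
      then show "x \<noteq> 0" using R by auto
      then have "1 / norm x < R" using nx R by (simp add: field_simps)
      then have "1 / T0 < h (1 / norm x)"
        using R \<open>x \<noteq> 0\<close> levy_h_less_iff[of R "1 / norm x"] by simp
      then show "ereal (1 / h (1 / norm x)) < T"
        using T0 real \<open>x \<noteq> 0\<close> levy_h_pos[of "1 / norm x"] by (simp add: field_simps)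
    qed
    then have "cond_C4 A b N (ereal R)"
      unfolding cond_C4_def using c key by (intro exI[of _ "8 * (real K)\<^sup>2"]) (auto simp: V_def)
    then show ?thesis using R real by (intro exI[of _ "ereal R"]) auto
  next
    case MInf
    then show ?thesis using assms by simp
  qed
qed

lemma C2_imp_C4:
  assumes "T > 0" "cond_C2 A b N T"
  shows "\<exists>T'>0. cond_C4 A b N T' \<and> (T = \<infinity> \<longrightarrow> T' = \<infinity>)"
proof -
  obtain c where "c > 0" "\<And>t. 0 < t \<Longrightarrow> ereal t < T \<Longrightarrow>
      (\<integral>\<^sup>+ z. ennreal (exp (- t * \<Psi>\<^sub>R z)) \<partial>lborel) \<le> ennreal (c * h_inv (1 / t) powr (- real CARD('n)))"
    using assms(2) unfolding cond_C2_def by blast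
  then show ?thesis
    using C4_of_exp_integral_bound[OF assms(1), of c 1] by simp
qed

text \<open>At \<open>r = 1 / h_inv (1 / t)\<close> one has \<open>1 / t = h (1 / r)\<close>,
  comparable to \<open>\<Psi>\<^sub>S r\<close>. Growth from radius \<open>r\<close> then makes
  \<open>t * \<Psi>\<^sub>R z\<close> at least \<open>a * (|z| / r) powr \<alpha>\<close> for
  \<open>|z| \<ge> r\<close>, and the integral is of order \<open>r^d\<close>.\<close>

lemma C3_imp_C2:
  assumes "T > 0" "cond_C3 A b N T"
  shows "\<exists>T'>0. cond_C2 A b N T' \<and> (T = \<infinity> \<longrightarrow> T' = \<infinity>)"
proof -
  obtain c \<alpha> where c: "0 < c" "c \<le> 1" "0 < \<alpha>"
    and C3: "\<And>x. 1 / T < ereal (norm x) \<Longrightarrow> c * \<Psi>\<^sub>S (norm x) \<le> \<Psi>\<^sub>R x"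
    and C3': "\<And>l r. 1 \<le> l \<Longrightarrow> 1 / T < ereal r \<Longrightarrow> c * l powr \<alpha> * \<Psi>\<^sub>S r \<le> \<Psi>\<^sub>S (l * r)"
    using assms(2) unfolding cond_C3_def by auto
  \<comment> \<open>One factor \<open>c\<close> from each half of (C3), and \<open>C\<^sub>d\<close>
    from \<open>1 / t \<le> C\<^sub>d * \<Psi>\<^sub>S r\<close>.\<close>
  define a where "a = c\<^sup>2 / C\<^sub>d"
  have a: "a > 0" using c C\<^sub>d_ge_1 by (simp add: a_def)
  obtain B where B: "B > 0"
    "\<And>(f :: real^'n \<Rightarrow> real) r. r > 0 \<Longrightarrow> (\<And>z. f z \<le> 1) \<Longrightarrow>
       (\<And>z. r \<le> norm z \<Longrightarrow> f z \<le> exp (- a * (norm z / r) powr \<alpha>)) \<Longrightarrow>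
       (\<integral>\<^sup>+z. ennreal (f z) \<partial>lborel) \<le> ennreal (B * r ^ DIM(real^'n))"
    using nn_integral_exp_powr_le[OF a c(3), where 'a="real^'n"] by blast
  have key: "(\<integral>\<^sup>+ z. ennreal (exp (- t * \<Psi>\<^sub>R z)) \<partial>lborel) \<le> ennreal (B * h_inv (1 / t) powr (- real CARD('n)))"
    if t: "t > 0" and tT: "1 / T < ereal (1 / h_inv (1 / t))" for t
  proof -
    define r where "r = 1 / h_inv (1 / t)"
    have r: "r > 0" "h (1 / r) = 1 / t" "1 / T < ereal r"
      using t tT by (auto simp: r_def levy_h_inv_pos levy_h_levy_h_inv)
    have "(\<integral>\<^sup>+ z. ennreal (exp (- t * \<Psi>\<^sub>R z)) \<partial>lborel) \<le> ennreal (B * r ^ DIM(real^'n))"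
    proof (rule B(2))
      show "exp (- t * \<Psi>\<^sub>R z) \<le> 1" for z using t Re_levy_exponent_nonneg[of z] by simp
      fix z :: "real^'n" assume z: "r \<le> norm z"
      let ?l = "norm z / r"
      have l: "1 \<le> ?l" "?l * r = norm z" using z r by auto
      have zT: "1 / T < ereal (norm z)"
        using r(3) z by (metis ereal_less_eq(3) less_le_trans)
      have "1 / t \<le> C\<^sub>d * \<Psi>\<^sub>S r" using h_le_psi_star[OF r(1)] r(2) by simp
      then have "c\<^sup>2 * ?l powr \<alpha> * (1 / t) \<le> c\<^sup>2 * ?l powr \<alpha> * (C\<^sub>d * \<Psi>\<^sub>S r)"
        by (intro mult_left_mono) auto
      also have "\<dots> = C\<^sub>d * (c * (c * ?l powr \<alpha> * \<Psi>\<^sub>S r))" by (simp add: power2_eq_square mult_ac)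
      also have "\<dots> \<le> C\<^sub>d * (c * \<Psi>\<^sub>S (norm z))"
        using C3'[OF l(1) r(3)] l(2) c C\<^sub>d_ge_1 by (intro mult_left_mono) auto
      also have "\<dots> \<le> C\<^sub>d * \<Psi>\<^sub>R z"
        using C3[OF zT] C\<^sub>d_ge_1 by (intro mult_left_mono) auto
      finally have "a * ?l powr \<alpha> \<le> t * \<Psi>\<^sub>R z"
        using t C\<^sub>d_ge_1 by (simp add: a_def field_simps)
      then show "exp (- t * \<Psi>\<^sub>R z) \<le> exp (- a * ?l powr \<alpha>)" by simp
    qed (use r in auto)
    also have "r ^ DIM(real^'n) = h_inv (1 / t) powr (- real CARD('n))"
      using levy_h_inv_pos[of "1 / t"] t
      by (simp add: r_def powr_minus powr_realpow power_one_over inverse_eq_divide)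
    finally show ?thesis .
  qed
  show ?thesis
  proof (cases T)
    case PInf
    then have "cond_C2 A b N \<infinity>"
      unfolding cond_C2_def using B(1) key levy_h_inv_pos by (intro exI[of _ B]) auto
    then show ?thesis by (intro exI[of _ \<infinity>]) auto
  next
    case (real T0)
    then have T0: "T0 > 0" using assms by simp
    have hT: "h T0 > 0" using T0 by (rule levy_h_pos)
    \<comment> \<open>For times below \<open>1 / h T0\<close> the radius
      \<open>r = 1 / h_inv (1 / t)\<close> exceeds \<open>1 / T0\<close>, where (C3) is
      available.\<close>
    have "1 / T < ereal (1 / h_inv (1 / t))" if t: "t > 0" "t < 1 / h T0" for t
    proof -
      have "h T0 < 1 / t" using t hT by (simp add: field_simps)
      then have "h_inv (1 / t) < T0"
        using levy_h_less_iff[of T0 "h_inv (1 / t)"] levy_h_inv_pos[of "1 / t"] levy_h_levy_h_inv[of "1 / t"] t T0 by simp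
      then show ?thesis
        using real T0 levy_h_inv_pos[of "1 / t"] t by (simp add: one_ereal_def field_simps)
    qed
    then have "cond_C2 A b N (ereal (1 / h T0))"
      unfolding cond_C2_def using B(1) key by (intro exI[of _ B]) auto
    then show ?thesis using hT real by (intro exI[of _ "ereal (1 / h T0)"]) auto
  next
    case MInf
    then show ?thesis using assms by simp
  qed
qed

end

section \<open>The laws \<open>\<mu> t\<close>: implications from and to (C1)\<close>

text \<open>The process enters only through its laws at positive times, each given by its
  characteristic function.\<close>

locale levy_process = levy_unbounded A b N
  for A :: "real^'n^'n" and b :: "real^'n" and N :: "(real^'n) measure" +
  fixes \<mu> :: "real \<Rightarrow> (real^'n) measure"
  assumes \<mu>_prob: "\<And>t. t > 0 \<Longrightarrow> prob_space (\<mu> t)"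
    and \<mu>_sets: "\<And>t. t > 0 \<Longrightarrow> sets (\<mu> t) = sets borel"
    and \<mu>_char: "\<And>t x. t > 0 \<Longrightarrow> (CLINT y|\<mu> t. cis (x \<bullet> y)) = exp (- (complex_of_real t * levy_exponent A b N x))"
begin

lemma norm_char_fun: "t > 0 \<Longrightarrow> norm (char_fun (\<mu> t) x) = exp (- t * \<Psi>\<^sub>R x)"
  by (simp add: char_fun_def \<mu>_char)

lemma C1_imp_C4:
  assumes "T > 0" "cond_C1 \<mu> A N T"
  shows "\<exists>T'>0. cond_C4 A b N T' \<and> (T = \<infinity> \<longrightarrow> T' = \<infinity>)"
proof -
  obtain p c where p: "\<And>t. t > 0 \<Longrightarrow> p t \<in> borel_measurable lborel" "\<And>t x. t > 0 \<Longrightarrow> 0 \<le> p t x"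
      "\<And>t. t > 0 \<Longrightarrow> \<mu> t = density lborel (\<lambda>x. ennreal (p t x))"
    and c: "c > 0" "\<And>t x. t > 0 \<Longrightarrow> ereal t < T \<Longrightarrow> p t x \<le> c * h_inv (1 / t) powr (- real CARD('n))"
    using assms(2) unfolding cond_C1_def by blast
  show ?thesis
  proof (rule C4_of_exp_integral_bound[OF assms(1)])
    show "(2 * pi) ^ CARD('n) * c > 0" "(2::real) > 0" using c by auto
    fix t :: real assume t: "0 < t" "ereal t < T"
    have "(\<integral>\<^sup>+z. ennreal ((norm (char_fun (\<mu> t) z))\<^sup>2) \<partial>lborel)
        \<le> ennreal ((2 * pi) ^ DIM(real^'n) * (c * h_inv (1 / t) powr (- real CARD('n))))"
      using t p c by (intro nn_integral_char_fun_sq_le[where p="p t"] \<mu>_prob) auto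
    moreover have "(norm (char_fun (\<mu> t) z))\<^sup>2 = exp (- 2 * t * \<Psi>\<^sub>R z)" for z
      using t by (simp add: norm_char_fun exp_double[symmetric] mult.assoc)
    ultimately show "(\<integral>\<^sup>+ z. ennreal (exp (- 2 * t * \<Psi>\<^sub>R z)) \<partial>lborel)
        \<le> ennreal ((2 * pi) ^ CARD('n) * c * h_inv (1 / t) powr (- real CARD('n)))"
      by (simp add: mult.assoc)
  qed
qed

text \<open>The inversion bound divides the integral in (C2) by \<open>(2 * pi) ^ d\<close>. Besides
  the bound for \<open>t\<close> below \<open>T\<close>, (C1) demands a density at every positive
  time.\<close>

lemma C2_imp_C1:
  assumes "T > 0" "cond_C2 A b N T"
  shows "cond_C1 \<mu> A N T"
proof -
  obtain c where c: "c > 0" and C2: "\<And>t. 0 < t \<Longrightarrow> ereal t < T \<Longrightarrow>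
      (\<integral>\<^sup>+ z. ennreal (exp (- t * \<Psi>\<^sub>R z)) \<partial>lborel) \<le> ennreal (c * h_inv (1 / t) powr (- real CARD('n)))"
    using assms(2) unfolding cond_C2_def by blast
  define D :: real where "D = (2 * pi) ^ CARD('n)"
  have D: "D > 0" by (simp add: D_def)
  have int: "integrable lborel (char_fun (\<mu> t))" if t: "t > 0" for t
  proof -
    obtain e where e: "0 < ereal e" "ereal e < T" using ereal_dense2[OF assms(1)] by blast
    \<comment> \<open>The modulus \<open>exp (- t * \<Psi>\<^sub>R z)\<close> is nonincreasing in
      \<open>t\<close>, so integrability at a time inside the range of (C2) passes to all later
      times.\<close>
    define s where "s = min t e"
    have s: "0 < s" "s \<le> t" "ereal s < T"
      using t e by (auto simp: s_def min_def intro: le_less_trans[of _ "ereal e"])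
    have "(\<integral>\<^sup>+ z. ennreal (norm (char_fun (\<mu> t) z)) \<partial>lborel) \<le> (\<integral>\<^sup>+ z. ennreal (exp (- s * \<Psi>\<^sub>R z)) \<partial>lborel)"
      using t s Re_levy_exponent_nonneg
      by (intro nn_integral_mono ennreal_leI) (auto simp: norm_char_fun intro!: mult_right_mono)
    also have "\<dots> < \<infinity>" using C2[OF s(1,3)] by (rule le_less_trans) simp
    finally show ?thesis
      using char_fun_measurable[OF \<mu>_prob[OF t] \<mu>_sets[OF t]] by (simp add: integrable_iff_bounded)
  qed
  have "\<forall>t. \<exists>p. t > 0 \<longrightarrow> p \<in> borel_measurable borel \<and> (\<forall>x. 0 \<le> p x) \<and>
      (\<forall>x. p x \<le> (\<integral>z. norm (char_fun (\<mu> t) z) \<partial>lborel) / D) \<and> \<mu> t = density lborel (\<lambda>x. ennreal (p x))"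
  proof
    fix t :: real
    show "\<exists>p. t > 0 \<longrightarrow> p \<in> borel_measurable borel \<and> (\<forall>x. 0 \<le> p x) \<and>
      (\<forall>x. p x \<le> (\<integral>z. norm (char_fun (\<mu> t) z) \<partial>lborel) / D) \<and> \<mu> t = density lborel (\<lambda>x. ennreal (p x))"
    proof (cases "t > 0")
      case True
      obtain p where "p \<in> borel_measurable borel" "\<And>x. 0 \<le> p x"
        "\<And>x. p x \<le> (\<integral>z. norm (char_fun (\<mu> t) z) \<partial>lborel) / (2 * pi) ^ DIM(real^'n)"
        "\<mu> t = density lborel (\<lambda>x. ennreal (p x))"
        using density_of_integrable_char_fun[OF \<mu>_prob[OF True] \<mu>_sets[OF True] int[OF True]] by blast
      then show ?thesis by (intro exI[of _ p]) (auto simp: D_def)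
    qed simp
  qed
  then obtain p where p: "\<And>t. t > 0 \<Longrightarrow> p t \<in> borel_measurable borel" "\<And>t x. t > 0 \<Longrightarrow> 0 \<le> p t x"
      "\<And>t x. t > 0 \<Longrightarrow> p t x \<le> (\<integral>z. norm (char_fun (\<mu> t) z) \<partial>lborel) / D"
      "\<And>t. t > 0 \<Longrightarrow> \<mu> t = density lborel (\<lambda>x. ennreal (p t x))"
    by metis
  have bound: "p t x \<le> c / D * h_inv (1 / t) powr (- real CARD('n))" if t: "t > 0" "ereal t < T" for t x
  proof -
    have "ennreal (\<integral>z. norm (char_fun (\<mu> t) z) \<partial>lborel) = (\<integral>\<^sup>+z. ennreal (norm (char_fun (\<mu> t) z)) \<partial>lborel)"
      using int[OF t(1)] by (intro nn_integral_eq_integral[symmetric] integrable_norm) auto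
    also have "\<dots> \<le> ennreal (c * h_inv (1 / t) powr (- real CARD('n)))"
      using C2[OF t] t by (simp add: norm_char_fun)
    finally have "(\<integral>z. norm (char_fun (\<mu> t) z) \<partial>lborel) \<le> c * h_inv (1 / t) powr (- real CARD('n))"
      using c by (subst (asm) ennreal_le_iff) auto
    then have "(\<integral>z. norm (char_fun (\<mu> t) z) \<partial>lborel) / D \<le> c * h_inv (1 / t) powr (- real CARD('n)) / D"
      using D by (intro divide_right_mono) auto
    then show ?thesis using p(3)[OF t(1), of x] by simp
  qed
  show ?thesis
    unfolding cond_C1_def
    using p c D bound by (intro exI[of _ p] conjI exI[of _ "c / D"] allI impI) auto
qed

end

theorem theorem3p1:
  fixes A :: "real^'n^'n" and b :: "real^'n" and N :: "(real^'n) measure"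
    and \<mu> :: "real \<Rightarrow> (real^'n) measure"
  assumes A_sym: "transpose A = A"
    and A_psd: "\<forall>x. 0 \<le> x \<bullet> (A *v x)"
    and N_levy: "is_levy_measure N"
    and h_inf: "filterlim (levy_h A N) at_top (at_right 0)"
    and \<mu>_prob: "\<forall>t>0. prob_space (\<mu> t) \<and> sets (\<mu> t) = sets borel"
    and \<mu>_char: "\<forall>t>0. \<forall>x. (CLINT y|\<mu> t. cis (x \<bullet> y)) = exp (- (complex_of_real t * levy_exponent A b N x))"
  shows "((\<exists>T>0. cond_C1 \<mu> A N T) \<longleftrightarrow> (\<exists>T>0. cond_C2 A b N T))
       \<and> ((\<exists>T>0. cond_C2 A b N T) \<longleftrightarrow> (\<exists>T>0. cond_C3 A b N T))
       \<and> ((\<exists>T>0. cond_C3 A b N T) \<longleftrightarrow> (\<exists>T>0. cond_C4 A b N T))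
       \<and> ((cond_C1 \<mu> A N \<infinity> \<or> cond_C2 A b N \<infinity> \<or> cond_C3 A b N \<infinity> \<or> cond_C4 A b N \<infinity>) \<longrightarrow>
          (cond_C1 \<mu> A N \<infinity> \<and> cond_C2 A b N \<infinity> \<and> cond_C3 A b N \<infinity> \<and> cond_C4 A b N \<infinity>))"
proof -
  interpret levy_process A b N \<mu>
    by (intro levy_process.intro levy_unbounded.intro levy_triplet.intro
        levy_process_axioms.intro levy_unbounded_axioms.intro) (simp_all add: assms)
  have inf: "P \<infinity>" if "\<exists>T'>0. P T' \<and> ((\<infinity>::ereal) = \<infinity> \<longrightarrow> T' = \<infinity>)" for P :: "ereal \<Rightarrow> bool"
    using that by auto
  have C14: "(\<exists>T>0. cond_C1 \<mu> A N T) \<longrightarrow> (\<exists>T>0. cond_C4 A b N T)"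
    using C1_imp_C4 by blast
  have C14_inf: "cond_C1 \<mu> A N \<infinity> \<longrightarrow> cond_C4 A b N \<infinity>"
    by (intro impI inf[OF C1_imp_C4[of \<infinity>]]) simp
  have C24: "(\<exists>T>0. cond_C2 A b N T) \<longrightarrow> (\<exists>T>0. cond_C4 A b N T)"
    using C2_imp_C4 by blast
  have C24_inf: "cond_C2 A b N \<infinity> \<longrightarrow> cond_C4 A b N \<infinity>"
    by (intro impI inf[OF C2_imp_C4[of \<infinity>]]) simp
  have C43: "(\<exists>T>0. cond_C4 A b N T) \<longrightarrow> (\<exists>T>0. cond_C3 A b N T)"
    using C4_imp_C3 by blast
  have C43_inf: "cond_C4 A b N \<infinity> \<longrightarrow> cond_C3 A b N \<infinity>"
    by (intro impI C4_imp_C3[of \<infinity>]) simp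
  have C32: "(\<exists>T>0. cond_C3 A b N T) \<longrightarrow> (\<exists>T>0. cond_C2 A b N T)"
    using C3_imp_C2 by blast
  have C32_inf: "cond_C3 A b N \<infinity> \<longrightarrow> cond_C2 A b N \<infinity>"
    by (intro impI inf[OF C3_imp_C2[of \<infinity>]]) simp
  have C21: "(\<exists>T>0. cond_C2 A b N T) \<longrightarrow> (\<exists>T>0. cond_C1 \<mu> A N T)"
    using C2_imp_C1 by blast
  have C21_inf: "cond_C2 A b N \<infinity> \<longrightarrow> cond_C1 \<mu> A N \<infinity>"
    by (intro impI C2_imp_C1[of \<infinity>]) simp
  show ?thesis
    using C14 C24 C43 C32 C21 C14_inf C24_inf C43_inf C32_inf C21_inf by argo
qed

end
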